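(* A graph is an edge extremal minimal bipartite matching covered graph if and only if it is obtained from a star by isomorphic leaf matching.
   Context: All graphs are finite and loopless; parallel edges are allowed. For a graph $G=(V,E)$ write $n=|V|$. A connected graph on four or more vertices is matching covered if every edge lies in some perfect matching. A matching covered graph is minimal if deleting any single edge yields a graph that is not matching covered. A minimal bipartite matching covered graph is edge extremal if $|E|=\frac{3n-6}{2}$. A star is $K_{1,p}$ with $p\geq 2$. A graph $H$ is obtained from a tree $T$ (on at least two vertices) by isomorphic leaf matching if, for a disjoint copy $T'$ of $T$ and some fixed isomorphism from $T$ to $T'$, $H$ is obtained from $T\cup T'$ by adding, for each leaf of $T$, one edge joining this leaf to the corresponding leaf of $T'$ under the isomorphism. *)

theory Defs
  imports Complex_Main
begin

text \<open>
  Finite loopless multigraphs. Edges are abstract objects, so that distinct edges may have the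
  same set of ends. The value of \<open>ends\<close> outside \<open>edges\<close> is irrelevant; hence no definition
  below compares two graphs by record equality.
\<close>

record ('v, 'e) mgraph =
  verts :: "'v set"
  edges :: "'e set"
  ends :: "'e \<Rightarrow> 'v set"

definition multigraph :: "('v, 'e) mgraph \<Rightarrow> bool" where
  "multigraph G \<longleftrightarrow>
     finite (verts G) \<and> finite (edges G) \<and>
     (\<forall>e\<in>edges G. ends G e \<subseteq> verts G \<and> card (ends G e) = 2)"

definition is_walk :: "('v, 'e) mgraph \<Rightarrow> 'v list \<Rightarrow> 'e list \<Rightarrow> bool" where
  "is_walk G vs es \<longleftrightarrow>
     length vs = Suc (length es) \<and> set vs \<subseteq> verts G \<and> set es \<subseteq> edges G \<and>
     (\<forall>i<length es. ends G (es ! i) = {vs ! i, vs ! Suc i})"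

definition connected_graph :: "('v, 'e) mgraph \<Rightarrow> bool" where
  "connected_graph G \<longleftrightarrow>
     verts G \<noteq> {} \<and>
     (\<forall>u\<in>verts G. \<forall>v\<in>verts G. \<exists>vs es. is_walk G vs es \<and> hd vs = u \<and> last vs = v)"

text \<open>
  Two parallel edges form a cycle of length 2; distinctness of the edges excludes traversing
  a single edge back and forth.
\<close>

definition is_cycle :: "('v, 'e) mgraph \<Rightarrow> 'v list \<Rightarrow> 'e list \<Rightarrow> bool" where
  "is_cycle G vs es \<longleftrightarrow>
     is_walk G vs es \<and> es \<noteq> [] \<and> hd vs = last vs \<and> distinct (tl vs) \<and> distinct es"

definition tree :: "('v, 'e) mgraph \<Rightarrow> bool" where
  "tree T \<longleftrightarrow> multigraph T \<and> connected_graph T \<and> \<not> (\<exists>vs es. is_cycle T vs es)"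

definition degree :: "('v, 'e) mgraph \<Rightarrow> 'v \<Rightarrow> nat" where
  "degree G v = card {e \<in> edges G. v \<in> ends G e}"

definition leaves :: "('v, 'e) mgraph \<Rightarrow> 'v set" where
  "leaves T = {v \<in> verts T. degree T v = 1}"

definition bipartite :: "('v, 'e) mgraph \<Rightarrow> bool" where
  "bipartite G \<longleftrightarrow>
     (\<exists>A B. A \<inter> B = {} \<and> verts G = A \<union> B \<and>
            (\<forall>e\<in>edges G. \<exists>a\<in>A. \<exists>b\<in>B. ends G e = {a, b}))"

definition perfect_matching :: "('v, 'e) mgraph \<Rightarrow> 'e set \<Rightarrow> bool" where
  "perfect_matching G M \<longleftrightarrow>
     M \<subseteq> edges G \<and> (\<forall>v\<in>verts G. \<exists>!e. e \<in> M \<and> v \<in> ends G e)"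

definition matching_covered :: "('v, 'e) mgraph \<Rightarrow> bool" where
  "matching_covered G \<longleftrightarrow>
     connected_graph G \<and> 4 \<le> card (verts G) \<and>
     (\<forall>e\<in>edges G. \<exists>M. perfect_matching G M \<and> e \<in> M)"

definition delete_edge :: "('v, 'e) mgraph \<Rightarrow> 'e \<Rightarrow> ('v, 'e) mgraph" where
  "delete_edge G e = G\<lparr>edges := edges G - {e}\<rparr>"

definition minimal_matching_covered :: "('v, 'e) mgraph \<Rightarrow> bool" where
  "minimal_matching_covered G \<longleftrightarrow>
     matching_covered G \<and> (\<forall>e\<in>edges G. \<not> matching_covered (delete_edge G e))"

definition edge_extremal :: "('v, 'e) mgraph \<Rightarrow> bool" where
  "edge_extremal G \<longleftrightarrow>
     bipartite G \<and> minimal_matching_covered G \<and>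
     real (card (edges G)) = (3 * real (card (verts G)) - 6) / 2"

definition complete_bipartite :: "('v, 'e) mgraph \<Rightarrow> nat \<Rightarrow> nat \<Rightarrow> bool" where
  "complete_bipartite G p q \<longleftrightarrow>
     multigraph G \<and>
     (\<exists>A B. A \<inter> B = {} \<and> verts G = A \<union> B \<and> card A = p \<and> card B = q \<and>
            (\<forall>e\<in>edges G. \<exists>a\<in>A. \<exists>b\<in>B. ends G e = {a, b}) \<and>
            (\<forall>a\<in>A. \<forall>b\<in>B. \<exists>!e. e \<in> edges G \<and> ends G e = {a, b}))"

definition star :: "('v, 'e) mgraph \<Rightarrow> bool" where
  "star T \<longleftrightarrow> (\<exists>p\<ge>2. complete_bipartite T 1 p)"

definition graph_iso ::
  "('v \<Rightarrow> 'w) \<Rightarrow> ('e \<Rightarrow> 'f) \<Rightarrow> ('v, 'e) mgraph \<Rightarrow> ('w, 'f) mgraph \<Rightarrow> bool" where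
  "graph_iso f g G H \<longleftrightarrow>
     bij_betw f (verts G) (verts H) \<and> bij_betw g (edges G) (edges H) \<and>
     (\<forall>e\<in>edges G. ends H (g e) = f ` ends G e)"

text \<open>
  \<open>T\<close> and its disjoint copy \<open>T'\<close> are literally subgraphs of \<open>H\<close>; the new edges are \<open>m v\<close>, one
  for each leaf \<open>v\<close> of \<open>T\<close>. For a fixed \<open>T\<close> this is not closed under isomorphism of \<open>H\<close>, but
  being obtained from \<^emph>\<open>some\<close> star is.
\<close>

definition isomorphic_leaf_matching :: "('v, 'e) mgraph \<Rightarrow> ('v, 'e) mgraph \<Rightarrow> bool" where
  "isomorphic_leaf_matching T H \<longleftrightarrow>
     tree T \<and> 2 \<le> card (verts T) \<and>
     (\<exists>T' f g m.
        graph_iso f g T T' \<and>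
        verts T \<inter> verts T' = {} \<and> edges T \<inter> edges T' = {} \<and>
        inj_on m (leaves T) \<and> m ` leaves T \<inter> (edges T \<union> edges T') = {} \<and>
        verts H = verts T \<union> verts T' \<and>
        edges H = edges T \<union> edges T' \<union> m ` leaves T \<and>
        (\<forall>e\<in>edges T. ends H e = ends T e) \<and>
        (\<forall>e\<in>edges T'. ends H e = ends T' e) \<and>
        (\<forall>v\<in>leaves T. ends H (m v) = {v, f v}))"

end

theory Submission
  imports Defs
begin

text \<open>
  A bipartite graph with colour classes \<open>A\<close>, \<open>B\<close> is matching covered iff, for one (equivalently,
  every) perfect matching, the digraph obtained by contracting that matching is strongly connected.
  Removing a last ear of this digraph shows that a minimal matching covered bipartite graph arises
  from a smaller minimal one (or a single edge) by adding a path of odd length \<open>2m + 1\<close> with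
  \<open>m \<ge> 1\<close>. The ends of this path are nonadjacent, as otherwise it makes the edge joining them
  redundant. With \<open>k = |A| \<ge> 3\<close>, counting gives at most \<open>3k - 3\<close> edges by induction, and equality
  forces either the hexagon or an ear with \<open>m = 1\<close> added to an extremal graph. By induction the
  latter comes from a star, and minimality allows such an ear only between the two centres.
\<close>

section \<open>Ear decompositions of elementary bipartite relations\<close>

text \<open>Elementarity must not depend on the matching that defines the digraph. This freedom is
  what excludes an ear with adjacent ends \<open>x\<close> and \<open>y\<close>: one passes to a
  perfect matching avoiding the edge \<open>(x, y)\<close>, so that deleting this edge costs a
  single arc, which the ear bypasses.

  An ear adds \<open>m\<close> to \<open>k\<close> and at most \<open>2m + 1\<close> edges, against
  the \<open>3m\<close> that the bound allows; hence only \<open>m = 1\<close> can preserve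
  equality. The bound fails for \<open>k = 1\<close> (a single edge) and for \<open>k = 2\<close>
  (the four-cycle), so the induction cannot start there. An ear on a single edge gives a cycle with
  \<open>2m + 2\<close> edges, and \<open>2m + 2 = 3(m + 1) - 3\<close> singles out the hexagon. In
  the four-cycle any two vertices of opposite colours are adjacent, so no ear fits.

  Minimality excludes parallel edges; the combinatorics is therefore done for a relation between the
  colour classes, and multigraphs enter only afterwards.\<close>

definition pmatch :: "'a set \<Rightarrow> 'b set \<Rightarrow> ('a \<times> 'b) set \<Rightarrow> ('a \<Rightarrow> 'b) \<Rightarrow> bool" where
  "pmatch A B R \<mu> \<longleftrightarrow> bij_betw \<mu> A B \<and> (\<forall>a\<in>A. (a, \<mu> a) \<in> R)"

text \<open>The digraph obtained from a bipartite graph by contracting the perfect matching \<open>\<mu>\<close>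
  and directing the remaining edges from \<open>A\<close> to \<open>B\<close>. The matching edges become loops,
  which do not affect strong connectivity.\<close>

definition arcs :: "'a set \<Rightarrow> ('a \<times> 'b) set \<Rightarrow> ('a \<Rightarrow> 'b) \<Rightarrow> ('a \<times> 'a) set" where
  "arcs A R \<mu> = {(a, a'). a \<in> A \<and> a' \<in> A \<and> (a, \<mu> a') \<in> R}"

definition strong :: "'a set \<Rightarrow> ('a \<times> 'a) set \<Rightarrow> bool" where
  "strong A D \<longleftrightarrow> (\<forall>a\<in>A. \<forall>a'\<in>A. (a, a') \<in> D\<^sup>*)"

text \<open>A single edge counts as elementary, although matching covered graphs have at least four
  vertices: ear decompositions start from it. The choice of \<open>\<mu>\<close> is immaterial by
  \<open>elementary_strong\<close>.\<close>

definition elementary :: "'a set \<Rightarrow> 'b set \<Rightarrow> ('a \<times> 'b) set \<Rightarrow> bool" where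
  "elementary A B R \<longleftrightarrow> finite A \<and> R \<subseteq> A \<times> B \<and> (\<exists>\<mu>. pmatch A B R \<mu> \<and> strong A (arcs A R \<mu>))"

definition min_elementary :: "'a set \<Rightarrow> 'b set \<Rightarrow> ('a \<times> 'b) set \<Rightarrow> bool" where
  "min_elementary A B R \<longleftrightarrow> elementary A B R \<and> (\<forall>e\<in>R. \<not> elementary A B (R - {e}))"

text \<open>The bipartite graph obtained from a star by isomorphic leaf matching: \<open>c\<close> and \<open>d\<close> are the
  centres of the two copies, \<open>\<phi>\<close> matches the leaves of the copy at \<open>d\<close> with those at \<open>c\<close>.\<close>

definition star_rel :: "'a set \<Rightarrow> 'b set \<Rightarrow> ('a \<times> 'b) set \<Rightarrow> 'a \<Rightarrow> 'b \<Rightarrow> ('a \<Rightarrow> 'b) \<Rightarrow> bool" where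
  "star_rel A B R c d \<phi> \<longleftrightarrow> c \<in> A \<and> d \<in> B \<and> bij_betw \<phi> (A - {c}) (B - {d}) \<and>
     R = {(a, b). a = c \<and> b \<in> B - {d} \<or> a \<in> A - {c} \<and> (b = d \<or> b = \<phi> a)}"

text \<open>The path \<open>x, \<nu> v\<^sub>1, v\<^sub>1, \<dots>, \<nu> v\<^sub>m, v\<^sub>m, y\<close> of odd length \<open>2m + 1\<close>, with inner vertices
  \<open>v\<^sub>i\<close> and \<open>\<nu> v\<^sub>i\<close>.\<close>

definition ear :: "('a \<Rightarrow> 'b) \<Rightarrow> 'a \<Rightarrow> 'a list \<Rightarrow> 'b \<Rightarrow> ('a \<times> 'b) set" where
  "ear \<nu> x vs y = (\<lambda>v. (v, \<nu> v)) ` set vs \<union> set (zip (x # vs) (map \<nu> vs @ [y]))"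

section \<open>Strong connectivity via closed sets, and rerouting of perfect matchings\<close>

lemma arcs_subset: "arcs A R \<mu> \<subseteq> A \<times> A"
  by (auto simp: arcs_def)

lemma arcs_mono: "R \<subseteq> R' \<Longrightarrow> A \<subseteq> A' \<Longrightarrow> arcs A R \<mu> \<subseteq> arcs A' R' \<mu>"
  by (auto simp: arcs_def)

lemma strong_mono: "strong A D \<Longrightarrow> D \<subseteq> D' \<Longrightarrow> strong A D'"
  unfolding strong_def using rtrancl_mono by blast

lemma strong_closed:
  assumes "strong A D" "S \<subseteq> A" "S \<noteq> {}" "D `` S \<subseteq> S"
  shows "S = A"
  using assms Image_closed_trancl[OF assms(4)] unfolding strong_def by blast

text \<open>The set reachable from a vertex is nonempty and closed, hence everything. In this form
  strong connectivity can be derived by counting the neighbours of a closed set, without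
  constructing paths.\<close>

lemma strongI_closed:
  assumes "D \<subseteq> A \<times> A"
    and "\<And>S. S \<subseteq> A \<Longrightarrow> S \<noteq> {} \<Longrightarrow> D `` S \<subseteq> S \<Longrightarrow> S = A"
  shows "strong A D"
  unfolding strong_def
proof (intro ballI)
  fix a a' assume a: "a \<in> A" "a' \<in> A"
  have "D\<^sup>* `` {a} \<subseteq> A"
  proof
    fix x assume "x \<in> D\<^sup>* `` {a}"
    then have "(a, x) \<in> D\<^sup>*" by auto
    then show "x \<in> A" using a assms(1) by (induction) auto
  qed
  then have "D\<^sup>* `` {a} = A"
    by (rule assms(2)) (auto intro: rtrancl.rtrancl_into_rtrancl)
  then show "(a, a') \<in> D\<^sup>*" using a by auto
qed

lemma strong_hubI:
  assumes "\<And>a. a \<in> A \<Longrightarrow> (c, a) \<in> D\<^sup>*" "\<And>a. a \<in> A \<Longrightarrow> (a, c) \<in> D\<^sup>*"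
  shows "strong A D"
  unfolding strong_def using assms by (meson rtrancl_trans)

lemma elementary_finite:
  assumes "elementary A B R" shows "finite A" "finite B" "finite R" "card A = card B"
proof -
  obtain \<mu> where m: "bij_betw \<mu> A B" and f: "finite A" and R: "R \<subseteq> A \<times> B"
    using assms unfolding elementary_def pmatch_def by blast
  show "finite A" by fact
  show fB: "finite B" using m f bij_betw_finite by blast
  show "finite R" using R f fB finite_subset by blast
  show "card A = card B" using m bij_betw_same_card by blast
qed

lemma elementary_mono:
  assumes "elementary A B R" "R \<subseteq> R'" "R' \<subseteq> A \<times> B"
  shows "elementary A B R'"
proof -
  obtain \<mu> where \<mu>: "pmatch A B R \<mu>" "strong A (arcs A R \<mu>)" "finite A"
    using assms unfolding elementary_def by blast
  have "pmatch A B R' \<mu>" using \<mu>(1) assms(2) by (auto simp: pmatch_def)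
  moreover have "strong A (arcs A R' \<mu>)"
    using strong_mono[OF \<mu>(2) arcs_mono[OF assms(2) order_refl]] .
  ultimately show ?thesis unfolding elementary_def using \<mu>(3) assms(3) by blast
qed

text \<open>Elementarity passes to larger relations, so resisting the deletion of each single edge
  amounts to resisting the deletion of any nonempty set of edges.\<close>

lemma min_elementary_subset_eq:
  assumes "min_elementary A B R" "elementary A B R'" "R' \<subseteq> R"
  shows "R' = R"
proof (rule ccontr)
  assume "R' \<noteq> R"
  then obtain e where e: "e \<in> R" "R' \<subseteq> R - {e}" using assms(3) by blast
  then show False
    using assms elementary_mono[OF assms(2) e(2)]
    unfolding min_elementary_def elementary_def by blast
qed

text \<open>A set closed under the arcs of one perfect matching has no more neighbours than elements,
  hence is closed under the arcs of every perfect matching.\<close>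

lemma elementary_strong:
  assumes el: "elementary A B R" and pm: "pmatch A B R \<mu>"
  shows "strong A (arcs A R \<mu>)"
proof (rule strongI_closed[OF arcs_subset])
  fix S assume S: "S \<subseteq> A" "S \<noteq> {}" "arcs A R \<mu> `` S \<subseteq> S"
  obtain \<mu>' where pm': "pmatch A B R \<mu>'" and st: "strong A (arcs A R \<mu>')"
    and fin: "finite A" and R: "R \<subseteq> A \<times> B"
    using el unfolding elementary_def by blast
  have fS: "finite S" using S fin finite_subset by blast
  have N: "R `` S \<subseteq> \<mu> ` S"
  proof
    fix b assume "b \<in> R `` S"
    then obtain a where a: "a \<in> S" "(a, b) \<in> R" by auto
    then obtain a' where "a' \<in> A" "b = \<mu> a'"
      using R pm unfolding pmatch_def bij_betw_def by blast
    then show "b \<in> \<mu> ` S" using a S by (auto simp: arcs_def)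
  qed
  have sub: "\<mu>' ` S \<subseteq> \<mu> ` S" using pm' S N unfolding pmatch_def by blast
  have "card (\<mu>' ` S) = card (\<mu> ` S)"
    using pm pm' S unfolding pmatch_def bij_betw_def
    by (metis card_image inj_on_subset)
  then have eq: "\<mu>' ` S = \<mu> ` S" using sub fS by (simp add: card_subset_eq)
  have "arcs A R \<mu>' `` S \<subseteq> S"
  proof
    fix a' assume "a' \<in> arcs A R \<mu>' `` S"
    then obtain a where "a \<in> S" "a' \<in> A" "(a, \<mu>' a') \<in> R" by (auto simp: arcs_def)
    then have "\<mu>' a' \<in> \<mu>' ` S" using N eq by blast
    then show "a' \<in> S" using pm' S \<open>a' \<in> A\<close> unfolding pmatch_def bij_betw_def
      by (meson inj_on_image_mem_iff)
  qed
  then show "S = A" using strong_closed[OF st S(1,2)] by blast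
qed

text \<open>Of a path from \<open>v\<close> to \<open>u\<close>, keep only what follows the last
  visit to \<open>v\<close>. The rest avoids \<open>v\<close>, so \<open>v\<close> can be removed in
  the induction of \<open>shift_along_path\<close>.\<close>

lemma rtrancl_last_exit:
  assumes "(v, u) \<in> (D \<inter> X \<times> X)\<^sup>*" "u \<noteq> v"
  shows "\<exists>w. (v, w) \<in> D \<and> w \<in> X - {v} \<and> (w, u) \<in> (D \<inter> (X - {v}) \<times> (X - {v}))\<^sup>*"
  using assms
proof (induction rule: rtrancl_induct)
  case (step y z)
  show ?case
  proof (cases "y = v")
    case True
    then show ?thesis using step by blast
  next
    case False
    then obtain w where "(v, w) \<in> D" "w \<in> X - {v}"
      "(w, y) \<in> (D \<inter> (X - {v}) \<times> (X - {v}))\<^sup>*" using step by blast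
    moreover have "(y, z) \<in> D \<inter> (X - {v}) \<times> (X - {v})" using step False by blast
    ultimately show ?thesis by (meson rtrancl.rtrancl_into_rtrancl)
  qed
qed simp

text \<open>\<open>\<tau>\<close> sends each vertex of a path from \<open>v\<close> to
  \<open>u\<close>, except \<open>u\<close>, to its successor and fixes the vertices off the path.
  In terms of the matching this is a switch along an alternating path.\<close>

lemma shift_along_path:
  assumes "finite X" "(v, u) \<in> (D \<inter> X \<times> X)\<^sup>*" "v \<in> X"
  shows "\<exists>\<tau>. bij_betw \<tau> (X - {u}) (X - {v}) \<and> (\<forall>x\<in>X - {u}. (x, \<tau> x) \<in> D \<or> \<tau> x = x)"
  using assms
proof (induction "card X" arbitrary: X v)
  case (Suc n)
  show ?case
  proof (cases "u = v")
    case True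
    then show ?thesis by (intro exI[of _ id]) auto
  next
    case False
    then obtain w where w: "(v, w) \<in> D" "w \<in> X - {v}"
      "(w, u) \<in> (D \<inter> (X - {v}) \<times> (X - {v}))\<^sup>*"
      using rtrancl_last_exit Suc.prems by metis
    have "n = card (X - {v})" using Suc by simp
    from Suc.hyps(1)[OF this _ w(3,2)] Suc.prems
    obtain \<tau> where t: "bij_betw \<tau> (X - {v} - {u}) (X - {v} - {w})"
      "\<forall>x\<in>X - {v} - {u}. (x, \<tau> x) \<in> D \<or> \<tau> x = x" by auto
    have "bij_betw (\<tau>(v := w)) (X - {v} - {u}) (X - {v} - {w})"
      using t(1) by (rule iffD1[OF bij_betw_cong, rotated]) auto
    moreover have "bij_betw (\<tau>(v := w)) {v} {w}" by (simp add: bij_betw_def)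
    ultimately have "bij_betw (\<tau>(v := w)) ((X - {v} - {u}) \<union> {v}) ((X - {v} - {w}) \<union> {w})"
      by (rule bij_betw_combine) auto
    moreover have "(X - {v} - {u}) \<union> {v} = X - {u}" "(X - {v} - {w}) \<union> {w} = X - {v}"
      using False w Suc.prems by auto
    ultimately show ?thesis using t w by (intro exI[of _ "\<tau>(v := w)"]) auto
  qed
qed auto

text \<open>If \<open>b = \<mu> v\<close>, the edge \<open>(a, b)\<close> is an arc from
  \<open>a\<close> to \<open>v\<close>. With a path from \<open>v\<close> back to \<open>a\<close>
  it forms a directed, that is, an alternating cycle, and switching along it puts
  \<open>(a, b)\<close> into the matching.\<close>

lemma elementary_edge_in_pmatch:
  assumes el: "elementary A B R" and e: "(a, b) \<in> R"
  shows "\<exists>\<mu>. pmatch A B R \<mu> \<and> \<mu> a = b"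
proof -
  obtain \<mu> where pm: "pmatch A B R \<mu>" and st: "strong A (arcs A R \<mu>)"
    and fin: "finite A" and R: "R \<subseteq> A \<times> B"
    using el unfolding elementary_def by blast
  obtain v where v: "v \<in> A" "b = \<mu> v" and a: "a \<in> A"
    using R e pm unfolding pmatch_def bij_betw_def by blast
  have "arcs A R \<mu> \<inter> A \<times> A = arcs A R \<mu>" using arcs_subset by blast
  then have "(v, a) \<in> (arcs A R \<mu> \<inter> A \<times> A)\<^sup>*" using st v a unfolding strong_def by simp
  from shift_along_path[OF fin this v(1)] obtain \<tau> where
    t: "bij_betw \<tau> (A - {a}) (A - {v})" "\<forall>x\<in>A - {a}. (x, \<tau> x) \<in> arcs A R \<mu> \<or> \<tau> x = x" by blast
  have bm: "bij_betw \<mu> (A - {v}) (B - {b})"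
    using pm v unfolding pmatch_def bij_betw_def by (auto simp: inj_on_def)
  define \<mu>' where "\<mu>' = (\<mu> \<circ> \<tau>)(a := b)"
  have "bij_betw (\<mu> \<circ> \<tau>) (A - {a}) (B - {b})" using t(1) bm bij_betw_trans by blast
  then have "bij_betw \<mu>' (A - {a}) (B - {b})"
    by (rule iffD1[OF bij_betw_cong, rotated]) (auto simp: \<mu>'_def)
  moreover have "bij_betw \<mu>' {a} {b}" by (simp add: \<mu>'_def bij_betw_def)
  ultimately have "bij_betw \<mu>' ((A - {a}) \<union> {a}) ((B - {b}) \<union> {b})"
    by (rule bij_betw_combine) auto
  moreover have "(A - {a}) \<union> {a} = A" "(B - {b}) \<union> {b} = B" using a e R by auto
  moreover have "(x, \<mu>' x) \<in> R" if "x \<in> A" for x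
    using t(2) that e pm by (auto simp: \<mu>'_def arcs_def pmatch_def)
  ultimately show ?thesis unfolding pmatch_def by (intro exI[of _ \<mu>']) (auto simp: \<mu>'_def)
qed

section \<open>Degrees, and attaching and detaching ears\<close>

lemma strong_out_arc:
  assumes "strong A D" "D \<subseteq> A \<times> A" "S \<subseteq> A" "S \<noteq> {}" "S \<noteq> A"
  shows "\<exists>a a'. (a, a') \<in> D \<and> a \<in> S \<and> a' \<in> A - S"
  using strong_closed[OF assms(1,3,4)] assms by blast

text \<open>An arc leaving \<open>{a}\<close> is an edge at \<open>a\<close> other than
  \<open>(a, \<mu> a)\<close>. In \<open>elementary_degree_right\<close> an arc entering the partner
  of \<open>b\<close> plays the same part.\<close>

lemma elementary_degree_left:
  assumes el: "elementary A B R" and "2 \<le> card A" "a \<in> A"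
  shows "\<exists>b b'. b \<noteq> b' \<and> (a, b) \<in> R \<and> (a, b') \<in> R"
proof -
  obtain \<mu> where pm: "pmatch A B R \<mu>" and st: "strong A (arcs A R \<mu>)"
    using el unfolding elementary_def by blast
  have "{a} \<noteq> A" using assms by force
  then obtain a' where "(a, a') \<in> arcs A R \<mu>" "a' \<noteq> a" "a' \<in> A"
    using strong_out_arc[OF st arcs_subset, of "{a}"] assms by blast
  then show ?thesis using pm assms unfolding pmatch_def arcs_def bij_betw_def inj_on_def
    by blast
qed

lemma elementary_degree_right:
  assumes el: "elementary A B R" and "2 \<le> card A" "b \<in> B"
  shows "\<exists>a a'. a \<noteq> a' \<and> (a, b) \<in> R \<and> (a', b) \<in> R"
proof -
  obtain \<mu> where pm: "pmatch A B R \<mu>" and st: "strong A (arcs A R \<mu>)"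
    using el unfolding elementary_def by blast
  obtain a where a: "a \<in> A" "b = \<mu> a" using pm assms unfolding pmatch_def bij_betw_def by blast
  have "A - {a} \<noteq> {}" using assms using card_mono[of "{a}" A] by auto
  then obtain a' where "(a', a) \<in> arcs A R \<mu>" "a' \<noteq> a"
    using strong_out_arc[OF st arcs_subset, of "A - {a}"] a by blast
  then show ?thesis using pm a unfolding pmatch_def arcs_def by blast
qed

lemma zip_path_reach:
  fixes F :: "'a list \<Rightarrow> 'a \<Rightarrow> 'a \<Rightarrow> ('a \<times> 'a) set"
  defines "F \<equiv> \<lambda>vs x y. set (zip (x # vs) (vs @ [y]))"
  shows "(x, y) \<in> (F vs x y)\<^sup>* \<and> (\<forall>v\<in>set vs. (x, v) \<in> (F vs x y)\<^sup>* \<and> (v, y) \<in> (F vs x y)\<^sup>*)"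
proof (induction vs arbitrary: x)
  case (Cons v vs)
  have F: "F (v # vs) x y = insert (x, v) (F vs v y)" by (simp add: F_def)
  have sub: "(F vs v y)\<^sup>* \<subseteq> (F (v # vs) x y)\<^sup>*" unfolding F by (rule rtrancl_mono) auto
  have one: "(x, v) \<in> (F (v # vs) x y)\<^sup>*" unfolding F by auto
  have step: "(x, u) \<in> (F (v # vs) x y)\<^sup>*" if "(v, u) \<in> (F vs v y)\<^sup>*" for u
    using rtrancl_trans[OF one subsetD[OF sub that]] .
  show ?case using step one sub Cons[of v] by auto
qed (auto simp: F_def)

text \<open>The arc \<open>(x, y)\<close> is only simulated: the path replaces it in every walk
  inside \<open>X\<close>. A vertex of the path is reached from \<open>x\<close> and returns to
  \<open>x\<close> via \<open>y\<close>, so \<open>x\<close> serves as a hub.\<close>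

lemma strong_add_path:
  assumes "strong X (insert (x, y) D)" "x \<in> X" "y \<in> X" "D \<subseteq> D'"
    and F: "set (zip (x # vs) (vs @ [y])) \<subseteq> D'"
  shows "strong (X \<union> set vs) D'"
proof -
  have F': "(set (zip (x # vs) (vs @ [y])))\<^sup>* \<subseteq> D'\<^sup>*" using F by (rule rtrancl_mono)
  have xy: "(x, y) \<in> D'\<^sup>*" using zip_path_reach[of x y vs] F' by blast
  have "(insert (x, y) D)\<^sup>* \<subseteq> (D'\<^sup>*)\<^sup>*"
    using xy assms(4) by (intro rtrancl_mono) auto
  then have X: "(a, b) \<in> D'\<^sup>*" if "a \<in> X" "b \<in> X" for a b
    using assms(1) that unfolding strong_def by auto
  have V: "(x, v) \<in> D'\<^sup>*" "(v, y) \<in> D'\<^sup>*" if "v \<in> set vs" for v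
    using zip_path_reach[of x y vs] that F' by blast+
  show ?thesis
  proof (rule strong_hubI[where c = x])
    fix a assume "a \<in> X \<union> set vs"
    then show "(x, a) \<in> D'\<^sup>*" using X V assms(2) by blast
    show "(a, x) \<in> D'\<^sup>*" using X V assms(2,3) \<open>a \<in> X \<union> set vs\<close> by (meson UnE rtrancl_trans)
  qed
qed

lemma exists_path_to_set:
  assumes "(v, z) \<in> D\<^sup>*" "D \<subseteq> A \<times> A" "v \<in> A - X" "z \<in> X"
  shows "\<exists>vs y. vs \<noteq> [] \<and> hd vs = v \<and> distinct vs \<and> set vs \<subseteq> A - X \<and> y \<in> X \<and>
    set (zip vs (tl vs @ [y])) \<subseteq> D"
  using assms(1,3)
proof (induction rule: converse_rtrancl_induct)
  case base
  then show ?case using assms by blast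
next
  case (step v w)
  show ?case
  proof (cases "w \<in> X")
    case True
    then show ?thesis using step by (intro exI[of _ "[v]"] exI[of _ w]) auto
  next
    case False
    then obtain vs y where vs: "vs \<noteq> []" "hd vs = w" "distinct vs" "set vs \<subseteq> A - X" "y \<in> X"
      "set (zip vs (tl vs @ [y])) \<subseteq> D" using step assms(2) by blast
    show ?thesis
    proof (cases "v \<in> set vs")
      case True
      \<comment> \<open>Prepending \<open>v\<close> would repeat it; the suffix starting at its
        occurrence is already a path from \<open>v\<close>.\<close>
      then obtain ys zs where s: "vs = ys @ v # zs" by (meson split_list)
      have "set (zip (v # zs) (zs @ [y])) \<subseteq> set (zip vs (tl vs @ [y]))"
      proof (cases ys)
        case (Cons a ys')
        have "zip vs (tl vs @ [y]) = zip (ys @ v # zs) ((ys' @ [v]) @ (zs @ [y]))"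
          unfolding s Cons by simp
        also have "\<dots> = zip ys (ys' @ [v]) @ zip (v # zs) (zs @ [y])"
          by (rule zip_append) (simp add: Cons)
        finally show ?thesis by simp
      qed (simp add: s)
      then show ?thesis using vs s by (intro exI[of _ "v # zs"] exI[of _ y]) auto
    next
      case False
      then show ?thesis using vs step by (intro exI[of _ "v # vs"] exI[of _ y])
        (cases vs; auto)
    qed
  qed
qed

text \<open>Take \<open>X\<close> to be a largest proper subset inducing a strongly connected subdigraph.\<close>

lemma strong_last_ear:
  assumes st: "strong A D" and D: "D \<subseteq> A \<times> A" and fin: "finite A" and "2 \<le> card A"
  obtains X x y vs where "X \<subset> A" "x \<in> X" "y \<in> X" "strong X (D \<inter> X \<times> X)"
    "vs \<noteq> []" "distinct vs" "set vs = A - X" "set (zip (x # vs) (vs @ [y])) \<subseteq> D"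
proof -
  define P where "P X \<longleftrightarrow> X \<subset> A \<and> X \<noteq> {} \<and> strong X (D \<inter> X \<times> X)" for X
  obtain a where "a \<in> A" using assms(4) by fastforce
  then have "P {a}" using assms(4) unfolding P_def strong_def by force
  moreover have "\<forall>X. P X \<longrightarrow> card X < Suc (card A)"
    unfolding P_def using fin by (simp add: card_mono psubset_imp_subset less_Suc_eq_le)
  ultimately have "\<exists>X. P X \<and> (\<forall>Y. P Y \<longrightarrow> card Y \<le> card X)"
    by (rule ex_has_greatest_nat)
  then obtain X where "P X \<and> (\<forall>Y. P Y \<longrightarrow> card Y \<le> card X)" ..
  then have X: "P X" "\<forall>Y. P Y \<longrightarrow> card Y \<le> card X" by simp_all
  obtain x v where xv: "(x, v) \<in> D" "x \<in> X" "v \<in> A - X"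
    using strong_out_arc[OF st D] X(1) unfolding P_def by blast
  have "(v, x) \<in> D\<^sup>*" using st xv X(1) unfolding strong_def P_def by blast
  from exists_path_to_set[OF this D xv(3,2)] obtain vs y where
    vs: "vs \<noteq> []" "hd vs = v" "distinct vs" "set vs \<subseteq> A - X" "y \<in> X"
      "set (zip vs (tl vs @ [y])) \<subseteq> D" by blast
  have path: "set (zip (x # vs) (vs @ [y])) \<subseteq> D" using vs xv by (cases vs) auto
  let ?Y = "X \<union> set vs"
  have "set (zip (x # vs) (vs @ [y])) \<subseteq> ?Y \<times> ?Y"
  proof (clarify, intro conjI SigmaI)
    fix a b assume "(a, b) \<in> set (zip (x # vs) (vs @ [y]))"
    from set_zip_leftD[OF this] set_zip_rightD[OF this]
    show "a \<in> ?Y" "b \<in> ?Y" using xv vs(5) by auto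
  qed
  then have path': "set (zip (x # vs) (vs @ [y])) \<subseteq> D \<inter> ?Y \<times> ?Y" using path by blast
  have "strong X (D \<inter> X \<times> X)" using X(1) unfolding P_def by simp
  then have "strong X (insert (x, y) (D \<inter> X \<times> X))" by (rule strong_mono) blast
  then have "strong ?Y (D \<inter> ?Y \<times> ?Y)"
    by (rule strong_add_path[OF _ xv(2) vs(5) _ path']) blast
  moreover have "card X < card ?Y"
  proof (rule psubset_card_mono)
    show "finite ?Y" using fin X(1) finite_subset[of X A] unfolding P_def by blast
    have "hd vs \<in> set vs" using vs(1) by simp
    then show "X \<subset> ?Y" using vs(4) by blast
  qed
  \<comment> \<open>By the choice of \<open>X\<close> the larger strongly connected set cannot be
    proper, so a single ear uses up all remaining vertices.\<close>
  ultimately have "\<not> ?Y \<subset> A" using X(1) X(2)[rule_format, of ?Y] xv(2) unfolding P_def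
    by auto
  then have "set vs = A - X" using vs(4) X(1) unfolding P_def by blast
  then show thesis using that[of X x y vs] X(1) xv vs path unfolding P_def by blast
qed

text \<open>The ear acts as the arc \<open>(x, x')\<close>, which therefore need not be present in \<open>Q\<close>.\<close>

lemma elementary_add_ear:
  assumes pm: "pmatch X Y Q \<mu>" and fin: "finite X" and Q: "Q \<subseteq> X \<times> Y"
    and st: "strong X (insert (x, x') (arcs X Q \<mu>))"
    and x: "x \<in> X" "x' \<in> X" and vs: "set vs \<inter> X = {}" "inj_on \<nu> (set vs)" "\<nu> ` set vs \<inter> Y = {}"
  shows "elementary (X \<union> set vs) (Y \<union> \<nu> ` set vs) (Q \<union> ear \<nu> x vs (\<mu> x'))"
proof -
  define \<mu>' where "\<mu>' v = (if v \<in> X then \<mu> v else \<nu> v)" for v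
  let ?R = "Q \<union> ear \<nu> x vs (\<mu> x')" and ?A = "X \<union> set vs" and ?B = "Y \<union> \<nu> ` set vs"
  have x'Y: "\<mu> x' \<in> Y" using pm x unfolding pmatch_def bij_betw_def by blast
  have m1: "bij_betw \<mu>' X Y"
    using pm unfolding pmatch_def by (auto simp: \<mu>'_def cong: bij_betw_cong)
  have "bij_betw \<nu> (set vs) (\<nu> ` set vs)" using vs by (simp add: bij_betw_def)
  then have m2: "bij_betw \<mu>' (set vs) (\<nu> ` set vs)"
    by (rule iffD1[OF bij_betw_cong, rotated]) (use vs in \<open>auto simp: \<mu>'_def\<close>)
  have "bij_betw \<mu>' ?A ?B" using m1 m2 by (rule bij_betw_combine) (use vs in auto)
  moreover have "(a, \<mu>' a) \<in> ?R" if "a \<in> ?A" for a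
    using that pm vs by (auto simp: \<mu>'_def pmatch_def ear_def)
  ultimately have pm': "pmatch ?A ?B ?R \<mu>'" unfolding pmatch_def by blast
  \<comment> \<open>Partners turn the linking edges of the ear into arcs of the path
    \<open>x\<close>, \<open>vs\<close>, \<open>x'\<close>: an edge to \<open>\<nu> v\<close> is an
    arc to \<open>v\<close>, the last edge an arc to \<open>x'\<close>.\<close>
  have zipR: "set (zip (x # vs) (vs @ [x'])) \<subseteq> arcs ?A ?R \<mu>'"
  proof
    fix p assume p: "p \<in> set (zip (x # vs) (vs @ [x']))"
    obtain a b where ab: "p = (a, b)" by force
    have "map \<mu>' (vs @ [x']) = map \<nu> vs @ [\<mu> x']" using vs x by (auto simp: \<mu>'_def)
    then have "zip (x # vs) (map \<nu> vs @ [\<mu> x']) = map (\<lambda>(a, b). (a, \<mu>' b)) (zip (x # vs) (vs @ [x']))"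
      by (simp only: flip: zip_map2)
    then have "(a, \<mu>' b) \<in> set (zip (x # vs) (map \<nu> vs @ [\<mu> x']))"
      using p unfolding ab by (simp only: set_map) force
    moreover have "a \<in> ?A" "b \<in> ?A"
      using set_zip_leftD[OF p[unfolded ab]] set_zip_rightD[OF p[unfolded ab]] x by auto
    ultimately show "p \<in> arcs ?A ?R \<mu>'" by (auto simp: arcs_def ear_def ab)
  qed
  have "strong ?A (arcs ?A ?R \<mu>')"
    by (rule strong_add_path[OF st x _ zipR]) (auto simp: arcs_def \<mu>'_def)
  moreover have "?R \<subseteq> ?A \<times> ?B"
  proof -
    have "a \<in> ?A \<and> b \<in> ?B" if "(a, b) \<in> set (zip (x # vs) (map \<nu> vs @ [\<mu> x']))" for a b
      using set_zip_leftD[OF that] set_zip_rightD[OF that] x x'Y by auto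
    then have "set (zip (x # vs) (map \<nu> vs @ [\<mu> x'])) \<subseteq> ?A \<times> ?B"
      by (intro subrelI) blast
    then show ?thesis using Q unfolding ear_def by blast
  qed
  ultimately show ?thesis using pm' fin unfolding elementary_def by blast
qed

lemma elementary_ear:
  assumes el: "elementary X Y Q" and x: "x \<in> X" "y \<in> Y"
    and vs: "set vs \<inter> X = {}" "inj_on \<nu> (set vs)" "\<nu> ` set vs \<inter> Y = {}"
  shows "elementary (X \<union> set vs) (Y \<union> \<nu> ` set vs) (Q \<union> ear \<nu> x vs y)"
proof -
  obtain \<mu> where pm: "pmatch X Y Q \<mu>" and st: "strong X (arcs X Q \<mu>)"
    and fin: "finite X" and Q: "Q \<subseteq> X \<times> Y"
    using el unfolding elementary_def by blast
  obtain x' where x': "x' \<in> X" "y = \<mu> x'" using pm x unfolding pmatch_def bij_betw_def by blast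
  show ?thesis unfolding x'(2)
    by (rule elementary_add_ear[OF pm fin Q _ x(1) x'(1) vs]) (auto intro: strong_mono[OF st])
qed

text \<open>If the ends of the ear are adjacent, the edge between them is redundant: the ear
  replaces it by a path of odd length.\<close>

lemma elementary_ear_replaces_edge:
  assumes el: "elementary X Y Q" and k: "2 \<le> card X" and xy: "(x, y) \<in> Q"
    and vs: "set vs \<inter> X = {}" "inj_on \<nu> (set vs)" "\<nu> ` set vs \<inter> Y = {}"
  shows "elementary (X \<union> set vs) (Y \<union> \<nu> ` set vs) ((Q - {(x, y)}) \<union> ear \<nu> x vs y)"
proof -
  have fin: "finite X" and Q: "Q \<subseteq> X \<times> Y" using el unfolding elementary_def by auto
  have x: "x \<in> X" "y \<in> Y" using xy Q by auto
  \<comment> \<open>A second edge at \<open>x\<close> lies in some perfect matching; that matching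
    does not use \<open>(x, y)\<close> and survives its deletion.\<close>
  obtain y' where "(x, y') \<in> Q" "y' \<noteq> y" using elementary_degree_left[OF el k x(1)] by metis
  then obtain \<mu> where pm: "pmatch X Y Q \<mu>" "\<mu> x \<noteq> y"
    using elementary_edge_in_pmatch[OF el] by metis
  have st: "strong X (arcs X Q \<mu>)" using elementary_strong[OF el pm(1)] .
  obtain x' where x': "x' \<in> X" "y = \<mu> x'" using pm x unfolding pmatch_def bij_betw_def by blast
  have pm': "pmatch X Y (Q - {(x, y)}) \<mu>" using pm unfolding pmatch_def by auto
  have inj: "inj_on \<mu> X" using pm unfolding pmatch_def bij_betw_def by blast
  \<comment> \<open>As \<open>y = \<mu> x'\<close>, the deletion costs just the arc
    \<open>(x, x')\<close>.\<close>
  have "arcs X Q \<mu> \<subseteq> insert (x, x') (arcs X (Q - {(x, y)}) \<mu>)"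
    using inj x' by (auto simp: arcs_def inj_on_def)
  from strong_mono[OF st this] show ?thesis unfolding x'(2)
    by (rule elementary_add_ear[OF pm'[unfolded x'(2)] fin _ _ x(1) x'(1) vs, rotated])
       (use Q in auto)
qed

text \<open>An edge of \<open>R\<close> neither in \<open>Q\<close> nor on the ear would be
  redundant, since \<open>Q\<close> with the ear is already elementary; minimality leaves none. An
  edge redundant in \<open>Q\<close> would stay redundant in \<open>R\<close>, because the same ear
  can be added after its deletion; so \<open>Q\<close> inherits minimality.\<close>

lemma min_elementary_last_ear:
  assumes mn: "min_elementary A B R" and k: "2 \<le> card A"
  obtains X Y Q x y vs \<nu> where "min_elementary X Y Q" "x \<in> X" "y \<in> Y" "vs \<noteq> []" "distinct vs"
    "set vs \<inter> X = {}" "A = X \<union> set vs" "inj_on \<nu> (set vs)" "\<nu> ` set vs \<inter> Y = {}"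
    "B = Y \<union> \<nu> ` set vs" "R = Q \<union> ear \<nu> x vs y" "Q \<inter> ear \<nu> x vs y = {}"
proof -
  obtain \<mu> where pm: "pmatch A B R \<mu>" and st: "strong A (arcs A R \<mu>)"
    and fin: "finite A" and R: "R \<subseteq> A \<times> B"
    using mn unfolding min_elementary_def elementary_def by blast
  from strong_last_ear[OF st arcs_subset fin k] obtain X x x' vs where
    X: "X \<subset> A" "x \<in> X" "x' \<in> X" "strong X (arcs A R \<mu> \<inter> X \<times> X)" "vs \<noteq> []" "distinct vs"
      "set vs = A - X" "set (zip (x # vs) (vs @ [x'])) \<subseteq> arcs A R \<mu>" by blast
  define Y where "Y = \<mu> ` X"
  define Q where "Q = R \<inter> X \<times> Y"
  define y where "y = \<mu> x'"
  have inj: "inj_on \<mu> A" and B: "B = \<mu> ` A" and mR: "\<forall>a\<in>A. (a, \<mu> a) \<in> R"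
    using pm unfolding pmatch_def bij_betw_def by auto
  have pmX: "pmatch X Y Q \<mu>"
    using X(1) inj mR unfolding pmatch_def bij_betw_def Y_def Q_def
    by (auto intro: inj_on_subset)
  have "arcs A R \<mu> \<inter> X \<times> X \<subseteq> arcs X Q \<mu>" by (auto simp: arcs_def Q_def Y_def)
  then have elQ: "elementary X Y Q"
    using pmX strong_mono[OF X(4)] X(1) fin finite_subset[of X A]
    unfolding elementary_def Q_def by blast
  have dis: "set vs \<inter> X = {}" using X by auto
  have injv: "inj_on \<mu> (set vs)" using inj X(7) by (auto intro: inj_on_subset)
  have disY: "\<mu> ` set vs \<inter> Y = {}"
    using inj X(1,7) unfolding Y_def by (auto simp: inj_on_def)
  have A: "A = X \<union> set vs" using X by auto
  have B': "B = Y \<union> \<mu> ` set vs" using B A Y_def by auto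
  have yY: "y \<in> Y" using X y_def Y_def by auto
  have "ear \<mu> x vs y \<subseteq> R"
  proof -
    have "map \<mu> vs @ [y] = map \<mu> (vs @ [x'])" by (simp add: y_def)
    moreover have "set (zip (x # vs) (map \<mu> (vs @ [x']))) \<subseteq> R"
      using X(8) unfolding zip_map2 arcs_def by auto
    ultimately show ?thesis using mR A by (auto simp: ear_def)
  qed
  then have "Q \<union> ear \<mu> x vs y = R"
    using elementary_ear[OF elQ X(2) yY dis injv disY] mn A B'
    by (intro min_elementary_subset_eq[of A B]) (auto simp: Q_def)
  moreover have "Q \<inter> ear \<mu> x vs y = {}"
  proof -
    \<comment> \<open>Every linking edge meets an inner vertex. For the first one this rests on
      \<open>vs\<close> being nonempty: the ear would otherwise be the edge \<open>(x, y)\<close>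
      itself.\<close>
    have "a \<in> set vs \<or> b \<in> \<mu> ` set vs" if "(a, b) \<in> set (zip (x # vs) (map \<mu> vs @ [y]))" for a b
    proof -
      obtain v vs' where v: "vs = v # vs'" using X(5) by (cases vs) auto
      have "(a, b) = (x, \<mu> v) \<or> (a, b) \<in> set (zip (v # vs') (map \<mu> vs' @ [y]))"
        using that v by simp
      then show ?thesis using set_zip_leftD[of a b "v # vs'"] v by auto
    qed
    then have "set (zip (x # vs) (map \<mu> vs @ [y])) \<inter> X \<times> Y = {}"
      using disY dis by blast
    then show ?thesis using dis by (auto simp: ear_def Q_def)
  qed
  moreover have "min_elementary X Y Q"
    unfolding min_elementary_def
  proof (intro conjI elQ ballI notI)
    fix e assume e: "e \<in> Q" "elementary X Y (Q - {e})"
    have "elementary A B ((Q - {e}) \<union> ear \<mu> x vs y)"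
      using elementary_ear[OF e(2) X(2) yY dis injv disY] A B' by simp
    moreover have "(Q - {e}) \<union> ear \<mu> x vs y = R - {e}" using calculation e(1)
        \<open>Q \<inter> ear \<mu> x vs y = {}\<close> \<open>Q \<union> ear \<mu> x vs y = R\<close> by blast
    ultimately show False using mn e \<open>Q \<union> ear \<mu> x vs y = R\<close> unfolding min_elementary_def by auto
  qed
  ultimately show thesis using that[of X Y Q x y vs \<mu>] X yY dis injv disY A B' by blast
qed

text \<open>There are \<open>m\<close> edges \<open>(v, \<nu> v)\<close> and \<open>m + 1\<close>
  linking edges, counting those at the two ends of the ear.\<close>

lemma card_ear: "card (ear \<nu> x vs y) \<le> 2 * length vs + 1"
proof -
  have "card (ear \<nu> x vs y) \<le> card ((\<lambda>v. (v, \<nu> v)) ` set vs) + card (set (zip (x # vs) (map \<nu> vs @ [y])))"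
    unfolding ear_def by (rule card_Un_le)
  also have "\<dots> \<le> length vs + length (zip (x # vs) (map \<nu> vs @ [y]))"
    by (meson add_mono card_image_le card_length le_trans finite_set)
  finally show ?thesis by simp
qed

section \<open>Minimal elementary relations with the maximal number of edges\<close>

lemma bij_betw_card_eqI:
  assumes "inj_on f A" "f ` A \<subseteq> B" "finite B" "card A = card B"
  shows "bij_betw f A B"
  using assms by (simp add: bij_betw_def card_image card_subset_eq)

text \<open>To cover both centres, pick a leaf \<open>l\<close>, match it with \<open>d\<close> and
  give its partner to \<open>c\<close>. The arcs then lead from \<open>c\<close> to every other
  leaf, from there to \<open>l\<close>, and from \<open>l\<close> back to \<open>c\<close>. The
  further leaf \<open>z\<close> is essential: for \<open>card A = 2\<close> the relation is a path
  with three edges, and no arc leads from \<open>c\<close> to \<open>l\<close>.\<close>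

lemma star_rel_elementary:
  assumes st: "star_rel A B R c d \<phi>" and fin: "finite A" and k: "3 \<le> card A"
  shows "elementary A B R"
proof -
  have c: "c \<in> A" "d \<in> B" and bij: "bij_betw \<phi> (A - {c}) (B - {d})"
    and R: "R = {(a, b). a = c \<and> b \<in> B - {d} \<or> a \<in> A - {c} \<and> (b = d \<or> b = \<phi> a)}"
    using st unfolding star_rel_def by auto
  have "2 \<le> card (A - {c})" using k c fin by simp
  then obtain l where l: "l \<in> A" "l \<noteq> c"
    by (metis Diff_iff card.empty ex_in_conv insertI1 not_numeral_le_zero)
  have "1 \<le> card (A - {c} - {l})" using k c l fin by (simp add: card_Diff_subset)
  then obtain z where z: "z \<in> A" "z \<noteq> c" "z \<noteq> l"
    by (metis Diff_iff card.empty ex_in_conv insertI1 not_one_le_zero)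
  define \<mu> where "\<mu> = \<phi>(c := \<phi> l, l := d)"
  have \<phi>: "\<phi> x \<in> B" "\<phi> x \<noteq> d" if "x \<in> A" "x \<noteq> c" for x
    using bij that unfolding bij_betw_def by blast+
  have inj: "\<phi> x = \<phi> y \<longleftrightarrow> x = y" if "x \<in> A" "x \<noteq> c" "y \<in> A" "y \<noteq> c" for x y
    using bij that unfolding bij_betw_def inj_on_def by blast
  have fB: "finite B" using bij fin by (metis bij_betw_finite finite_Diff_insert finite.emptyI finite_Diff2)
  have "card (A - {c}) = card (B - {d})" using bij by (rule bij_betw_same_card)
  then have cd: "card A = card B" using c fin fB
    by (metis card_Suc_Diff1)
  have "bij_betw \<mu> A B"
  proof (rule bij_betw_card_eqI[OF _ _ fB cd])
    show "inj_on \<mu> A" unfolding inj_on_def \<mu>_def using \<phi> inj l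
      by (auto split: if_splits)
    show "\<mu> ` A \<subseteq> B" using \<phi> l c unfolding \<mu>_def by auto
  qed
  moreover have "(a, \<mu> a) \<in> R" if "a \<in> A" for a
    unfolding R \<mu>_def using that \<phi> l by auto
  ultimately have pm: "pmatch A B R \<mu>" unfolding pmatch_def by blast
  have arc1: "(c, x) \<in> arcs A R \<mu>" if "x \<in> A" "x \<noteq> c" "x \<noteq> l" for x
    using that c \<phi> unfolding arcs_def R \<mu>_def by auto
  have arc2: "(x, l) \<in> arcs A R \<mu>" if "x \<in> A" "x \<noteq> c" for x
    using that l unfolding arcs_def R \<mu>_def by auto
  have arc3: "(l, c) \<in> arcs A R \<mu>" using l c unfolding arcs_def R \<mu>_def by auto
  have cl: "(c, l) \<in> (arcs A R \<mu>)\<^sup>*"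
    using arc1[OF z] arc2[OF z(1,2)] by (meson converse_rtrancl_into_rtrancl r_into_rtrancl)
  have "strong A (arcs A R \<mu>)"
  proof (rule strong_hubI[where c = c])
    fix a assume a: "a \<in> A"
    show "(c, a) \<in> (arcs A R \<mu>)\<^sup>*" using arc1[OF a] cl by (cases "a = c"; cases "a = l") auto
    show "(a, c) \<in> (arcs A R \<mu>)\<^sup>*" using arc2[OF a] arc3
      by (cases "a = c") (auto intro: converse_rtrancl_into_rtrancl)
  qed
  moreover have "R \<subseteq> A \<times> B" unfolding R using c \<phi> by auto
  ultimately show ?thesis using pm fin unfolding elementary_def by blast
qed

text \<open>Every edge of a star relation has an end of degree two.\<close>

lemma star_rel_min_elementary:
  assumes st: "star_rel A B R c d \<phi>" and fin: "finite A" and k: "3 \<le> card A"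
  shows "min_elementary A B R"
  unfolding min_elementary_def
proof (intro conjI ballI notI)
  show "elementary A B R" using star_rel_elementary[OF assms] .
  have c: "c \<in> A" "d \<in> B" and bij: "bij_betw \<phi> (A - {c}) (B - {d})"
    and R: "R = {(a, b). a = c \<and> b \<in> B - {d} \<or> a \<in> A - {c} \<and> (b = d \<or> b = \<phi> a)}"
    using st unfolding star_rel_def by auto
  have \<phi>: "\<phi> ` (A - {c}) = B - {d}" and inj: "inj_on \<phi> (A - {c})"
    using bij unfolding bij_betw_def by auto
  fix e assume e: "e \<in> R" "elementary A B (R - {e})"
  have k2: "2 \<le> card A" using k by simp
  \<comment> \<open>The end of degree two is \<open>y\<close>, joined to \<open>c\<close> and one
    leaf, in the first case, and \<open>x\<close>, joined to \<open>d\<close> and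
    \<open>\<phi> x\<close>, in the second. Deleting \<open>e\<close> would leave it with degree
    one.\<close>
  from e(1) consider y where "e = (c, y)" "y \<in> B" "y \<noteq> d"
    | x where "x \<in> A" "x \<noteq> c" "e = (x, d) \<or> e = (x, \<phi> x)" unfolding R by auto
  then show False
  proof cases
    case 1
    obtain a a' where "a \<noteq> a'" "(a, y) \<in> R - {e}" "(a', y) \<in> R - {e}"
      using elementary_degree_right[OF e(2) k2 1(2)] by blast
    then show False using 1 inj unfolding R inj_on_def by auto
  next
    case 2
    obtain b b' where "b \<noteq> b'" "(x, b) \<in> R - {e}" "(x, b') \<in> R - {e}"
      using elementary_degree_left[OF e(2) k2 2(1)] by blast
    then show False using 2 unfolding R by auto
  qed
qed

text \<open>An ear whose ends are nonadjacent joins either the two centres or a leaf \<open>x\<close> of one copy to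
  a leaf \<open>\<phi> z\<close> of the other. The latter is harmless only when the star has just two leaves: the
  hexagon is symmetric, so \<open>x\<close> and \<open>\<phi> z\<close> become the new centres. Otherwise a further leaf
  \<open>u\<close> provides a cycle that makes the edge from \<open>c\<close> to \<open>\<phi> z\<close> redundant.\<close>

lemma star_rel_add_ear:
  assumes st: "star_rel X Y Q c d \<phi>" and fin: "finite X"
    and v: "v \<notin> X" and w: "w \<notin> Y" and x: "x \<in> X" "y \<in> Y" "(x, y) \<notin> Q"
    and R: "R = Q \<union> {(v, w), (x, w), (v, y)}"
    and mn: "min_elementary (insert v X) (insert w Y) R"
  shows "\<exists>c d \<phi>. star_rel (insert v X) (insert w Y) R c d \<phi>"
proof -
  have c: "c \<in> X" "d \<in> Y" and bij: "bij_betw \<phi> (X - {c}) (Y - {d})"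
    and Q: "Q = {(a, b). a = c \<and> b \<in> Y - {d} \<or> a \<in> X - {c} \<and> (b = d \<or> b = \<phi> a)}"
    using st unfolding star_rel_def by auto
  have im: "\<phi> ` (X - {c}) = Y - {d}" using bij unfolding bij_betw_def by blast
  have \<phi>: "\<phi> x \<in> Y" "\<phi> x \<noteq> d" if "x \<in> X" "x \<noteq> c" for x
    using im that by blast+
  have inj: "\<phi> x = \<phi> y \<longleftrightarrow> x = y" if "x \<in> X" "x \<noteq> c" "y \<in> X" "y \<noteq> c" for x y
    using bij that unfolding bij_betw_def inj_on_def by blast
  consider "x = c" "y = d" | "x \<noteq> c" "y \<noteq> d" "y \<noteq> \<phi> x"
    using x unfolding Q by auto
  then show ?thesis
  proof cases
    case 1
    \<comment> \<open>The ear joins the centres, so \<open>v\<close> and \<open>w\<close> become a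
      new pair of matched leaves.\<close>
    have "bij_betw (\<phi>(v := w)) (X - {c}) (Y - {d})"
      using bij by (rule iffD1[OF bij_betw_cong, rotated]) (use v in auto)
    moreover have "bij_betw (\<phi>(v := w)) {v} {w}" by (simp add: bij_betw_def)
    ultimately have "bij_betw (\<phi>(v := w)) ((X - {c}) \<union> {v}) ((Y - {d}) \<union> {w})"
      by (rule bij_betw_combine) (use w in auto)
    moreover have "(X - {c}) \<union> {v} = insert v X - {c}" "(Y - {d}) \<union> {w} = insert w Y - {d}"
      using c v w by auto
    ultimately have "bij_betw (\<phi>(v := w)) (insert v X - {c}) (insert w Y - {d})" by simp
    moreover have "R = {(a, b). a = c \<and> b \<in> insert w Y - {d} \<or>
        a \<in> insert v X - {c} \<and> (b = d \<or> b = (\<phi>(v := w)) a)}"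
      unfolding R Q using 1 c v w by (auto split: if_splits)
    ultimately have "star_rel (insert v X) (insert w Y) R c d (\<phi>(v := w))"
      unfolding star_rel_def using c by blast
    then show ?thesis by blast
  next
    case 2
    obtain z where z: "z \<in> X" "z \<noteq> c" "y = \<phi> z" using im x(2) 2(2) by blast
    have xz: "x \<noteq> z" using 2 z by auto
    show ?thesis
    proof (cases "X = {c, x, z}")
      case True
      have Y: "Y = {d, \<phi> x, y}" using im c 2 z xz unfolding True by auto
      have ne: "c \<noteq> x" "c \<noteq> z" "x \<noteq> z" "v \<noteq> c" "v \<noteq> x" "v \<noteq> z" "w \<noteq> d" "w \<noteq> \<phi> x" "w \<noteq> y"
        "\<phi> x \<noteq> d" "y \<noteq> d" "y \<noteq> \<phi> x"
        using 2 z xz v w \<phi>[OF x(1)] unfolding True Y by auto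
      \<comment> \<open>The neighbours of \<open>y\<close> are now \<open>v\<close>,
        \<open>c\<close> and \<open>z\<close>; each has exactly one other neighbour, which is its
        value under \<open>\<psi>\<close>.\<close>
      define \<psi> where "\<psi> = (\<lambda>_. w)(c := \<phi> x, z := d)"
      have eqs: "insert v X - {x} = {v, c, z}" "insert w Y - {y} = {w, d, \<phi> x}"
        using ne unfolding True Y by auto
      have "bij_betw \<psi> (insert v X - {x}) (insert w Y - {y})"
        unfolding eqs \<psi>_def bij_betw_def using ne by (auto simp: inj_on_def)
      moreover have "R = {(a, b). a = x \<and> b \<in> insert w Y - {y} \<or>
          a \<in> insert v X - {x} \<and> (b = y \<or> b = \<psi> a)}"
        unfolding eqs unfolding R Q True Y \<psi>_def using ne z by auto
      ultimately have "star_rel (insert v X) (insert w Y) R x y \<psi>"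
        unfolding star_rel_def using x by blast
      then show ?thesis by blast
    next
      case False
      then obtain u where u: "u \<in> X" "u \<noteq> c" "u \<noteq> x" "u \<noteq> z" using c x z by auto
      \<comment> \<open>This matching avoids \<open>(c, y)\<close>, and its digraph without that
        edge contains the directed cycle \<open>c\<close>, \<open>u\<close>, \<open>z\<close>,
        \<open>v\<close>, \<open>x\<close>. Every other leaf lies between \<open>c\<close> and
        \<open>z\<close> just as \<open>u\<close> does.\<close>
      define \<mu> where "\<mu> = \<phi>(c := \<phi> x, x := w, v := y, z := d)"
      let ?A = "insert v X" and ?B = "insert w Y" and ?R = "R - {(c, y)}"
      have elR: "elementary ?A ?B R" using mn unfolding min_elementary_def by blast
      have ne: "v \<noteq> c" "v \<noteq> x" "v \<noteq> z" "v \<noteq> u" "w \<noteq> d" "w \<noteq> y"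
        using v w c x z u by auto
      have "bij_betw \<mu> ?A ?B"
      proof (rule bij_betw_card_eqI)
        show "inj_on \<mu> ?A" unfolding inj_on_def \<mu>_def
          using \<phi> inj 2 z x xz ne v w by (auto split: if_splits)
        show "\<mu> ` ?A \<subseteq> ?B" using \<phi> c x z unfolding \<mu>_def by auto
        show "finite ?B" "card ?A = card ?B" using elementary_finite[OF elR] by auto
      qed
      moreover have "(a, \<mu> a) \<in> ?R" if "a \<in> ?A" for a
        using that \<phi> 2 z x xz ne v w c unfolding R Q \<mu>_def by auto
      ultimately have pm: "pmatch ?A ?B ?R \<mu>" unfolding pmatch_def by blast
      let ?D = "arcs ?A ?R \<mu>"
      have a1: "(c, a) \<in> ?D" if "a \<in> X" "a \<noteq> c" "a \<noteq> x" "a \<noteq> z" for a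
        using that c z x ne v \<phi> inj unfolding arcs_def R Q \<mu>_def by auto
      have a2: "(a, z) \<in> ?D" if "a \<in> X" "a \<noteq> c" for a
        using that c z x ne v \<phi> unfolding arcs_def R Q \<mu>_def by auto
      have a3: "(z, v) \<in> ?D" using z unfolding arcs_def R Q \<mu>_def by auto
      have a4: "(v, x) \<in> ?D" using x ne xz unfolding arcs_def R Q \<mu>_def by auto
      have a5: "(x, c) \<in> ?D" using x c 2 ne z unfolding arcs_def R Q \<mu>_def by auto
      have r1: "(c, z) \<in> ?D\<^sup>*" using a1[OF u] a2[OF u(1,2)] by (meson converse_rtrancl_into_rtrancl r_into_rtrancl)
      then have r2: "(c, v) \<in> ?D\<^sup>*" using a3 by (rule rtrancl_into_rtrancl)
      then have r3: "(c, x) \<in> ?D\<^sup>*" using a4 by (rule rtrancl_into_rtrancl)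
      have s1: "(v, c) \<in> ?D\<^sup>*" using a4 a5 by (meson converse_rtrancl_into_rtrancl r_into_rtrancl)
      then have s2: "(z, c) \<in> ?D\<^sup>*" by (rule converse_rtrancl_into_rtrancl[OF a3])
      have "strong ?A ?D"
      proof (rule strong_hubI[where c = c])
        fix a assume a: "a \<in> ?A"
        show "(c, a) \<in> ?D\<^sup>*" using a a1 r1 r2 r3 by (cases "a = c"; cases "a = x"; cases "a = z") auto
        show "(a, c) \<in> ?D\<^sup>*" using a a2 s1 s2
          by (cases "a = c") (auto intro: converse_rtrancl_into_rtrancl)
      qed
      moreover have "finite ?A" "?R \<subseteq> ?A \<times> ?B" using elR unfolding elementary_def by auto
      ultimately have "elementary ?A ?B ?R" using pm unfolding elementary_def by blast
      moreover have "(c, y) \<in> R" using x 2 unfolding R Q by auto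
      ultimately show ?thesis using mn unfolding min_elementary_def by blast
    qed
  qed
qed

text \<open>The bound and the case of equality are proved together: equality for \<open>R\<close>
  forces equality for \<open>Q\<close>, whose shape is then needed. Both are stated additively
  because subtraction on naturals truncates.\<close>

lemma min_elementary_card:
  assumes "min_elementary A B R" "3 \<le> card A"
  shows "card R + 3 \<le> 3 * card A \<and>
    (card R + 3 = 3 * card A \<longrightarrow> (\<exists>c d \<phi>. star_rel A B R c d \<phi>))"
  using assms
proof (induction "card A" arbitrary: A B R rule: less_induct)
  case less
  note mn = less.prems(1) and k = less.prems(2)
  have elR: "elementary A B R" using mn unfolding min_elementary_def by blast
  have "2 \<le> card A" using k by simp
  from min_elementary_last_ear[OF mn this] obtain X Y Q x y vs \<nu> where
    mnQ: "min_elementary X Y Q" and x: "x \<in> X" "y \<in> Y" and vs: "vs \<noteq> []" "distinct vs"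
    "set vs \<inter> X = {}" and A: "A = X \<union> set vs" and \<nu>: "inj_on \<nu> (set vs)" "\<nu> ` set vs \<inter> Y = {}"
    and B: "B = Y \<union> \<nu> ` set vs" and R: "R = Q \<union> ear \<nu> x vs y" and QE: "Q \<inter> ear \<nu> x vs y = {}"
    by blast
  let ?m = "length vs"
  have elQ: "elementary X Y Q" using mnQ unfolding min_elementary_def by blast
  note finQ = elementary_finite[OF elQ]
  have QXY: "Q \<subseteq> X \<times> Y" using elQ unfolding elementary_def by blast
  have m: "1 \<le> ?m" using vs(1) by (cases vs) auto
  have cA: "card A = card X + ?m"
    unfolding A using vs finQ(1) by (simp add: card_Un_disjoint distinct_card Int_commute)
  have cR: "card R \<le> card Q + (2 * ?m + 1)"
    unfolding R using card_Un_le[of Q "ear \<nu> x vs y"] card_ear[of \<nu> x vs y] by linarith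
  have nadj: "(x, y) \<notin> Q" if k': "2 \<le> card X"
  proof
    assume xy: "(x, y) \<in> Q"
    have "R - {(x, y)} = (Q - {(x, y)}) \<union> ear \<nu> x vs y" using xy QE unfolding R by blast
    then have "elementary A B (R - {(x, y)})"
      using elementary_ear_replaces_edge[OF elQ k' xy vs(3) \<nu>] unfolding A B by simp
    then show False using mn xy unfolding min_elementary_def R by blast
  qed
  have "card X \<noteq> 0" using x finQ by auto
  then consider "card X = 1" | "card X = 2" | "3 \<le> card X" by linarith
  then show ?case
  proof cases
    case 1
    then have X: "X = {x}" and Y: "Y = {y}" using x finQ(4) by (metis card_1_singletonE singletonD)+
    have Q: "Q = {(x, y)}"
    proof -
      have "Q \<noteq> {}" using elQ x unfolding elementary_def pmatch_def by blast
      then show ?thesis using QXY unfolding X Y by auto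
    qed
    \<comment> \<open>At most \<open>2 * ?m + 2\<close> edges stand against
      \<open>card A = ?m + 1\<close>, where \<open>?m\<close> is at least two as
      \<open>3 \<le> card A\<close>.\<close>
    have "?m = 2 \<or> card R + 3 < 3 * card A" using cR cA 1 k Q by simp linarith
    moreover have "card R + 3 \<le> 3 * card A" using cR cA 1 k Q by simp
    moreover have "\<exists>c d \<phi>. star_rel A B R c d \<phi>" if m2: "?m = 2"
    proof -
      obtain u v where uv: "vs = [u, v]"
        using m2 by (auto simp: numeral_2_eq_2 length_Suc_conv)
      \<comment> \<open>In the hexagon \<open>x\<close>, \<open>\<nu> u\<close>, \<open>u\<close>,
        \<open>\<nu> v\<close>, \<open>v\<close>, \<open>y\<close> the opposite vertices
        \<open>x\<close> and \<open>\<nu> v\<close> serve as centres; \<open>\<psi>\<close> reads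
        off the two edges avoiding them.\<close>
      define \<psi> where "\<psi> = (\<lambda>_. y)(u := \<nu> u)"
      have ne: "u \<noteq> v" "u \<noteq> x" "v \<noteq> x" "\<nu> u \<noteq> \<nu> v" "\<nu> u \<noteq> y" "\<nu> v \<noteq> y"
        using vs(2,3) \<nu> unfolding X Y uv by auto
      have eqs: "A - {x} = {u, v}" "B - {\<nu> v} = {\<nu> u, y}"
        using ne unfolding A B X Y uv by auto
      have "bij_betw \<psi> (A - {x}) (B - {\<nu> v})"
        unfolding eqs \<psi>_def bij_betw_def using ne by auto
      moreover have "R = {(a, b). a = x \<and> b \<in> B - {\<nu> v} \<or>
          a \<in> A - {x} \<and> (b = \<nu> v \<or> b = \<psi> a)}"
        unfolding eqs unfolding R Q ear_def uv \<psi>_def using ne by auto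
      moreover have "x \<in> A" "\<nu> v \<in> B" unfolding A B X uv by auto
      ultimately have "star_rel A B R x (\<nu> v) \<psi>" unfolding star_rel_def by blast
      then show ?thesis by blast
    qed
    ultimately show ?thesis by auto
  next
    case 2
    \<comment> \<open>Two neighbours of \<open>x\<close> exhaust \<open>Y\<close>, so
      \<open>x\<close> and \<open>y\<close> are adjacent, against \<open>nadj\<close>.\<close>
    obtain b b' where b: "b \<noteq> b'" "(x, b) \<in> Q" "(x, b') \<in> Q"
      using elementary_degree_left[OF elQ _ x(1)] 2 by auto
    have "{b, b'} \<subseteq> Y" using b QXY by auto
    moreover have "card {b, b'} = card Y" using b 2 finQ by simp
    ultimately have "{b, b'} = Y" using finQ(2) by (metis card_subset_eq)
    then have "(x, y) \<in> Q" using x b by blast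
    then show ?thesis using nadj 2 by simp
  next
    case 3
    have IH: "card Q + 3 \<le> 3 * card X"
      "card Q + 3 = 3 * card X \<Longrightarrow> \<exists>c d \<phi>. star_rel X Y Q c d \<phi>"
      using less.hyps[OF _ mnQ 3] cA vs(1) by auto
    have "card R + 3 \<le> 3 * card A" using IH(1) cR cA m by simp
    moreover have "\<exists>c d \<phi>. star_rel A B R c d \<phi>" if "card R + 3 = 3 * card A"
    proof -
      have m1: "?m = 1" and "card Q + 3 = 3 * card X" using that IH(1) cR cA m by simp_all
      then obtain c d \<phi> where st: "star_rel X Y Q c d \<phi>" using IH(2) by blast
      obtain v where v: "vs = [v]" using m1 by (auto simp: length_Suc_conv)
      have R': "R = Q \<union> {(v, \<nu> v), (x, \<nu> v), (v, y)}" unfolding R ear_def v by auto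
      show ?thesis
        using star_rel_add_ear[OF st finQ(1) _ _ x nadj R'] mn vs(3) \<nu>(2) 3 unfolding A B v by auto
    qed
    ultimately show ?thesis by blast
  qed
qed

section \<open>Matching covered bipartite graphs\<close>

definition bipartition :: "('v, 'e) mgraph \<Rightarrow> 'v set \<Rightarrow> 'v set \<Rightarrow> bool" where
  "bipartition G A B \<longleftrightarrow> A \<inter> B = {} \<and> verts G = A \<union> B \<and>
     (\<forall>e\<in>edges G. \<exists>a\<in>A. \<exists>b\<in>B. ends G e = {a, b})"

text \<open>Pairs are oriented from \<open>A\<close> to \<open>B\<close>, and parallel edges
  collapse; injectivity of \<open>ends\<close> will express that there are none.\<close>

definition adj :: "('v, 'e) mgraph \<Rightarrow> 'v set \<Rightarrow> 'v set \<Rightarrow> ('v \<times> 'v) set" where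
  "adj G A B = {(a, b). a \<in> A \<and> b \<in> B \<and> (\<exists>e\<in>edges G. ends G e = {a, b})}"

text \<open>Together with \<open>connected_graphI_closed\<close> this trades walks for vertex sets
  that no edge leaves, the counterpart of the closed sets describing strong connectivity.\<close>

lemma connected_graph_closed:
  assumes "connected_graph G" "S \<subseteq> verts G" "S \<noteq> {}"
    and closed: "\<And>e. e \<in> edges G \<Longrightarrow> ends G e \<inter> S \<noteq> {} \<Longrightarrow> ends G e \<subseteq> S"
  shows "S = verts G"
proof -
  obtain u where u: "u \<in> S" using assms by blast
  have "v \<in> S" if v: "v \<in> verts G" for v
  proof -
    obtain vs es where w: "is_walk G vs es" "hd vs = u" "last vs = v"
      using assms(1,2) u v unfolding connected_graph_def by blast
    have len: "length vs = Suc (length es)" using w unfolding is_walk_def by simp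
    have "i < length vs \<Longrightarrow> vs ! i \<in> S" for i
    proof (induction i)
      case 0
      then show ?case using u w(2) by (metis hd_conv_nth length_greater_0_conv)
    next
      case (Suc i)
      then have "es ! i \<in> edges G" "ends G (es ! i) = {vs ! i, vs ! Suc i}"
        using w(1) len unfolding is_walk_def by auto
      moreover have "vs ! i \<in> S" using Suc by simp
      ultimately show ?case using closed by blast
    qed
    then have "vs ! (length vs - 1) \<in> S" using len by simp
    moreover have "vs \<noteq> []" using len by auto
    ultimately show "v \<in> S" using w(3) by (simp add: last_conv_nth)
  qed
  then show ?thesis using assms(2) by blast
qed

lemma connected_graphI_closed:
  assumes "verts G \<noteq> {}" and ends: "\<And>e. e \<in> edges G \<Longrightarrow> ends G e \<subseteq> verts G \<and> card (ends G e) = 2"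
    and closed: "\<And>S. S \<subseteq> verts G \<Longrightarrow> S \<noteq> {} \<Longrightarrow>
      (\<And>e. e \<in> edges G \<Longrightarrow> ends G e \<inter> S \<noteq> {} \<Longrightarrow> ends G e \<subseteq> S) \<Longrightarrow> S = verts G"
  shows "connected_graph G"
  unfolding connected_graph_def
proof (intro conjI ballI)
  show "verts G \<noteq> {}" by fact
  fix u v assume u: "u \<in> verts G" and v: "v \<in> verts G"
  define S where "S = {v. \<exists>vs es. is_walk G vs es \<and> hd vs = u \<and> last vs = v}"
  have "S = verts G"
  proof (rule closed)
    show "S \<subseteq> verts G"
    proof
      fix v assume "v \<in> S"
      then obtain vs es where w: "is_walk G vs es" "last vs = v" unfolding S_def by blast
      then have "vs \<noteq> []" "set vs \<subseteq> verts G" unfolding is_walk_def by auto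
      then show "v \<in> verts G" using w(2) last_in_set by blast
    qed
    have "is_walk G [u] []" using u by (simp add: is_walk_def)
    then have "u \<in> S" unfolding S_def by force
    then show "S \<noteq> {}" by blast
    fix e assume e: "e \<in> edges G" "ends G e \<inter> S \<noteq> {}"
    then obtain x where x: "x \<in> ends G e" "x \<in> S" by blast
    then obtain vs es where w: "is_walk G vs es" "hd vs = u" "last vs = x" unfolding S_def by blast
    show "ends G e \<subseteq> S"
    proof
      fix y assume y: "y \<in> ends G e"
      show "y \<in> S"
      proof (cases "y = x")
        case False
        then have xy: "ends G e = {x, y}"
          using ends[OF e(1)] x y by (auto simp: card_2_iff)
        have len: "length vs = Suc (length es)" using w unfolding is_walk_def by simp
        have "vs ! length es = x" using w(3) len by (cases vs rule: rev_cases) (auto simp: nth_append)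
        have "is_walk G (vs @ [y]) (es @ [e])"
          unfolding is_walk_def
        proof (intro conjI allI impI)
          fix i assume "i < length (es @ [e])"
          then consider "i < length es" | "i = length es" by fastforce
          then show "ends G ((es @ [e]) ! i) = {(vs @ [y]) ! i, (vs @ [y]) ! Suc i}"
          proof cases
            case 1
            then show ?thesis using w(1) unfolding is_walk_def by (simp add: nth_append)
          next
            case 2
            then show ?thesis using xy \<open>vs ! length es = x\<close> len by (simp add: nth_append)
          qed
        qed (use w(1) e(1) y ends[OF e(1)] in \<open>auto simp: is_walk_def\<close>)
        moreover have "hd (vs @ [y]) = u" using w(2) len by (cases vs) auto
        ultimately show ?thesis unfolding S_def by force
      qed (use x in simp)
    qed
  qed
  then show "\<exists>vs es. is_walk G vs es \<and> hd vs = u \<and> last vs = v" using v unfolding S_def by blast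
qed

text \<open>The last clause remembers the edges of \<open>M\<close>: a perfect matching through a
  given edge yields a function with a prescribed value.\<close>

lemma perfect_matching_imp_pmatch:
  assumes bp: "bipartition G A B" and M: "perfect_matching G M"
  shows "\<exists>\<mu>. pmatch A B (adj G A B) \<mu> \<and>
    (\<forall>e\<in>M. \<forall>a\<in>A. \<forall>b\<in>B. ends G e = {a, b} \<longrightarrow> \<mu> a = b)"
proof -
  have AB: "A \<inter> B = {}" and V: "verts G = A \<union> B"
    and E: "\<And>e. e \<in> edges G \<Longrightarrow> \<exists>a\<in>A. \<exists>b\<in>B. ends G e = {a, b}"
    using bp unfolding bipartition_def by auto
  have ME: "M \<subseteq> edges G" and ex1: "\<And>v. v \<in> verts G \<Longrightarrow> \<exists>!e. e \<in> M \<and> v \<in> ends G e"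
    using M unfolding perfect_matching_def by auto
  have uniq: "e = e'" if "e \<in> M" "e' \<in> M" "v \<in> ends G e" "v \<in> ends G e'" "v \<in> verts G" for e e' v
    using ex1[OF that(5)] that by blast
  have "\<forall>a\<in>A. \<exists>b. b \<in> B \<and> (\<exists>e\<in>M. ends G e = {a, b})"
  proof
    fix a assume a: "a \<in> A"
    then obtain e where e: "e \<in> M" "a \<in> ends G e" using ex1 V by blast
    then obtain a' b where ab: "a' \<in> A" "b \<in> B" "ends G e = {a', b}" using E ME by blast
    then have "a' = a" using e(2) a AB by auto
    then show "\<exists>b. b \<in> B \<and> (\<exists>e\<in>M. ends G e = {a, b})" using ab e by blast
  qed
  from bchoice[OF this] obtain \<mu> where
    "\<forall>a\<in>A. \<mu> a \<in> B \<and> (\<exists>e\<in>M. ends G e = {a, \<mu> a})" ..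
  then have \<mu>: "\<And>a. a \<in> A \<Longrightarrow> \<mu> a \<in> B \<and> (\<exists>e\<in>M. ends G e = {a, \<mu> a})" by blast
  have val: "\<mu> a = b" if ab: "e \<in> M" "ends G e = {a, b}" "a \<in> A" "b \<in> B" for e a b
  proof -
    obtain e' where e': "e' \<in> M" "ends G e' = {a, \<mu> a}" using \<mu>[OF ab(3)] by blast
    then have "e' = e" using uniq[of e' e a] ab V by auto
    then have "{a, \<mu> a} = {a, b}" using e' ab by simp
    then show ?thesis by (metis doubleton_eq_iff)
  qed
  have "inj_on \<mu> A"
  proof (rule inj_onI)
    fix a a' assume a: "a \<in> A" "a' \<in> A" "\<mu> a = \<mu> a'"
    then obtain e e' where e: "e \<in> M" "ends G e = {a, \<mu> a}" "e' \<in> M" "ends G e' = {a', \<mu> a}"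
      using \<mu> by metis
    then have "e = e'" using uniq[of e e' "\<mu> a"] \<mu>[OF a(1)] V by auto
    then have "{a, \<mu> a} = {a', \<mu> a}" using e by simp
    then show "a = a'" by (metis doubleton_eq_iff)
  qed
  moreover have "\<mu> ` A = B"
  proof
    show "\<mu> ` A \<subseteq> B" using \<mu> by blast
    show "B \<subseteq> \<mu> ` A"
    proof
      fix b assume b: "b \<in> B"
      then obtain e where e: "e \<in> M" "b \<in> ends G e" using ex1 V by blast
      then obtain a b' where ab: "a \<in> A" "b' \<in> B" "ends G e = {a, b'}" using E ME by blast
      then have "b' = b" using e(2) b AB by auto
      then show "b \<in> \<mu> ` A" using val[OF e(1)] ab by blast
    qed
  qed
  ultimately have "pmatch A B (adj G A B) \<mu>"
    using \<mu> ME unfolding pmatch_def bij_betw_def adj_def by blast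
  then show ?thesis using val by blast
qed

text \<open>A function fixes a matching only up to the choice among parallel edges. Prescribing
  \<open>e0\<close> at \<open>a0\<close> makes it possible to cover every edge, not just every
  adjacent pair.\<close>

lemma pmatch_imp_perfect_matching:
  assumes bp: "bipartition G A B" and pm: "pmatch A B (adj G A B) \<mu>"
    and e0: "e0 \<in> edges G" "ends G e0 = {a0, \<mu> a0}" "a0 \<in> A"
  obtains M where "perfect_matching G M" "e0 \<in> M"
proof -
  have AB: "A \<inter> B = {}" and V: "verts G = A \<union> B" using bp unfolding bipartition_def by auto
  have inj: "inj_on \<mu> A" and im: "\<mu> ` A = B" and adj: "\<And>a. a \<in> A \<Longrightarrow> (a, \<mu> a) \<in> adj G A B"
    using pm unfolding pmatch_def bij_betw_def by auto
  have "\<forall>a\<in>A. \<exists>e. e \<in> edges G \<and> ends G e = {a, \<mu> a} \<and> (a = a0 \<longrightarrow> e = e0)"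
  proof
    fix a assume "a \<in> A"
    then show "\<exists>e. e \<in> edges G \<and> ends G e = {a, \<mu> a} \<and> (a = a0 \<longrightarrow> e = e0)"
      using e0 adj[of a] unfolding adj_def by (cases "a = a0") auto
  qed
  from bchoice[OF this] obtain \<eta> where
    "\<forall>a\<in>A. \<eta> a \<in> edges G \<and> ends G (\<eta> a) = {a, \<mu> a} \<and> (a = a0 \<longrightarrow> \<eta> a = e0)" ..
  then have \<eta>: "\<And>a. a \<in> A \<Longrightarrow> \<eta> a \<in> edges G \<and> ends G (\<eta> a) = {a, \<mu> a}"
    "\<eta> a0 = e0" using e0(3) by auto
  have "perfect_matching G (\<eta> ` A)"
    unfolding perfect_matching_def
  proof (intro conjI ballI)
    show "\<eta> ` A \<subseteq> edges G" using \<eta> by blast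
    fix v assume "v \<in> verts G"
    then consider "v \<in> A" | a where "a \<in> A" "v = \<mu> a" using V im by blast
    then show "\<exists>!e. e \<in> \<eta> ` A \<and> v \<in> ends G e"
    proof cases
      case 1
      have "a = v" if "a \<in> A" "v \<in> ends G (\<eta> a)" for a
        using that 1 \<eta>(1)[OF that(1)] im AB by auto
      then show ?thesis using \<eta>(1)[OF 1] 1 by (intro ex1I[of _ "\<eta> v"]) auto
    next
      case 2
      have "a' = a" if "a' \<in> A" "v \<in> ends G (\<eta> a')" for a'
        using that 2 \<eta>(1)[OF that(1)] im AB inj unfolding inj_on_def by auto
      then show ?thesis using \<eta>(1)[OF 2(1)] 2 by (intro ex1I[of _ "\<eta> a"]) auto
    qed
  qed
  then show thesis using that \<eta>(2) e0(3) by blast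
qed

text \<open>If \<open>S\<close> is closed under the arcs, its neighbours are just its partners.
  Every perfect matching then maps \<open>S\<close> onto these, so an edge from outside
  \<open>S\<close> to one of them would lie in no perfect matching. Hence no edge leaves
  \<open>S\<close> and its partners, and connectedness gives \<open>S = A\<close>.\<close>

lemma matching_covered_imp_elementary:
  assumes mg: "multigraph G" and bp: "bipartition G A B" and mc: "matching_covered G"
  shows "elementary A B (adj G A B)"
proof -
  have AB: "A \<inter> B = {}" and V: "verts G = A \<union> B"
    and E: "\<And>e. e \<in> edges G \<Longrightarrow> \<exists>a\<in>A. \<exists>b\<in>B. ends G e = {a, b}"
    using bp unfolding bipartition_def by auto
  have conn: "connected_graph G" and four: "4 \<le> card (verts G)"
    and PM: "\<And>e. e \<in> edges G \<Longrightarrow> \<exists>M. perfect_matching G M \<and> e \<in> M"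
    using mc unfolding matching_covered_def by auto
  have fin: "finite A" using mg V unfolding multigraph_def by auto
  let ?R = "adj G A B"
  \<comment> \<open>Without edges the covering condition would be vacuous and yield no perfect
    matching to start from.\<close>
  have "edges G \<noteq> {}"
  proof
    assume "edges G = {}"
    obtain v where "v \<in> verts G" using four by fastforce
    then have "{v} = verts G" using \<open>edges G = {}\<close>
      by (intro connected_graph_closed[OF conn]) auto
    then have "card (verts G) = 1" by (metis is_singleton_altdef is_singletonI)
    then show False using four by simp
  qed
  then obtain M where "perfect_matching G M" using PM by blast
  from perfect_matching_imp_pmatch[OF bp this] obtain \<mu> where pm: "pmatch A B ?R \<mu>" by blast
  have im: "\<mu> ` A = B" and inj: "inj_on \<mu> A" using pm unfolding pmatch_def bij_betw_def by auto
  have "strong A (arcs A ?R \<mu>)"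
  proof (rule strongI_closed[OF arcs_subset])
    fix S assume S: "S \<subseteq> A" "S \<noteq> {}" "arcs A ?R \<mu> `` S \<subseteq> S"
    have N: "b \<in> \<mu> ` S" if ab: "a \<in> S" "(a, b) \<in> ?R" for a b
    proof -
      obtain a' where "a' \<in> A" "b = \<mu> a'" using ab(2) im unfolding adj_def by blast
      then show ?thesis using S ab unfolding arcs_def by blast
    qed
    have "S \<union> \<mu> ` S = verts G"
    proof (rule connected_graph_closed[OF conn])
      show "S \<union> \<mu> ` S \<subseteq> verts G" "S \<union> \<mu> ` S \<noteq> {}" using S V im by auto
      fix e assume e: "e \<in> edges G" "ends G e \<inter> (S \<union> \<mu> ` S) \<noteq> {}"
      obtain a b where ab: "a \<in> A" "b \<in> B" "ends G e = {a, b}" using E[OF e(1)] by blast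
      have abR: "(a, b) \<in> ?R" using ab e(1) unfolding adj_def by blast
      have "a \<in> S"
      proof (rule ccontr)
        assume a: "a \<notin> S"
        have "\<mu> ` S \<subseteq> B" using im S(1) by blast
        then have b: "b \<in> \<mu> ` S" using e(2) a ab S(1) AB by auto
        obtain M' where M': "perfect_matching G M'" "e \<in> M'" using PM[OF e(1)] by blast
        from perfect_matching_imp_pmatch[OF bp M'(1)] obtain \<mu>' where
          pm': "pmatch A B ?R \<mu>'" and "\<mu>' a = b" using M'(2) ab by metis
        have inj': "inj_on \<mu>' A" using pm' unfolding pmatch_def bij_betw_def by auto
        have "\<mu>' ` S \<subseteq> \<mu> ` S" using N pm' S(1) unfolding pmatch_def by blast
        moreover have "card (\<mu>' ` S) = card (\<mu> ` S)"
          using inj inj' S(1) by (metis card_image inj_on_subset)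
        ultimately have "\<mu>' ` S = \<mu> ` S"
          using fin S(1) by (meson card_subset_eq finite_imageI finite_subset)
        then have "\<mu>' a \<in> \<mu>' ` S" using b \<open>\<mu>' a = b\<close> by simp
        then show False using a inj' S(1) ab(1) by (simp add: inj_on_image_mem_iff)
      qed
      then show "ends G e \<subseteq> S \<union> \<mu> ` S" using N[OF _ abR] ab by auto
    qed
    moreover have "\<mu> ` S \<subseteq> B" using im S(1) by blast
    ultimately have "x \<in> S" if "x \<in> A" for x using that V AB by auto
    then show "S = A" using S(1) by blast
  qed
  moreover have "?R \<subseteq> A \<times> B" unfolding adj_def by auto
  ultimately show ?thesis using pm fin unfolding elementary_def by blast
qed

text \<open>A vertex set that no edge leaves contains the partners of its vertices, so its part in
  \<open>A\<close> is closed under the arcs and hence everything.\<close>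

lemma elementary_imp_matching_covered:
  assumes mg: "multigraph G" and bp: "bipartition G A B"
    and el: "elementary A B (adj G A B)" and k: "2 \<le> card A"
  shows "matching_covered G"
proof -
  have AB: "A \<inter> B = {}" and V: "verts G = A \<union> B"
    and E: "\<And>e. e \<in> edges G \<Longrightarrow> \<exists>a\<in>A. \<exists>b\<in>B. ends G e = {a, b}"
    using bp unfolding bipartition_def by auto
  let ?R = "adj G A B"
  obtain \<mu> where pm: "pmatch A B ?R \<mu>" and st: "strong A (arcs A ?R \<mu>)"
    using el unfolding elementary_def by blast
  have im: "\<mu> ` A = B" using pm unfolding pmatch_def bij_betw_def by auto
  have four: "4 \<le> card (verts G)"
    unfolding V using card_Un_disjoint[OF elementary_finite(1,2)[OF el] AB]
      elementary_finite(4)[OF el] k by simp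
  have "connected_graph G"
  proof (rule connected_graphI_closed)
    show "verts G \<noteq> {}" using four by auto
    show "ends G e \<subseteq> verts G \<and> card (ends G e) = 2" if "e \<in> edges G" for e
      using mg that unfolding multigraph_def by blast
    fix S assume S: "S \<subseteq> verts G" "S \<noteq> {}"
      and cl: "\<And>e. e \<in> edges G \<Longrightarrow> ends G e \<inter> S \<noteq> {} \<Longrightarrow> ends G e \<subseteq> S"
    have cl': "a \<in> S \<longleftrightarrow> b \<in> S" if ab: "(a, b) \<in> ?R" for a b
    proof -
      obtain e where e: "e \<in> edges G" "ends G e = {a, b}" using ab unfolding adj_def by blast
      show ?thesis using cl[OF e(1)] e(2) by auto
    qed
    have m: "a \<in> S \<longleftrightarrow> \<mu> a \<in> S" if "a \<in> A" for a
      using cl' pm that unfolding pmatch_def by blast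
    have "S \<inter> A = A"
    proof (rule strong_closed[OF st])
      show "S \<inter> A \<noteq> {}" using S V im m by blast
      show "arcs A ?R \<mu> `` (S \<inter> A) \<subseteq> S \<inter> A" using cl' m unfolding arcs_def by blast
    qed blast
    then show "S = verts G" using S(1) m im V by blast
  qed
  moreover have "\<exists>M. perfect_matching G M \<and> e \<in> M" if e: "e \<in> edges G" for e
  proof -
    obtain a b where ab: "a \<in> A" "b \<in> B" "ends G e = {a, b}" using E[OF e] by blast
    then have "(a, b) \<in> ?R" using e unfolding adj_def by blast
    then obtain \<mu>' where "pmatch A B ?R \<mu>'" "\<mu>' a = b"
      using elementary_edge_in_pmatch[OF el] by blast
    then show ?thesis using pmatch_imp_perfect_matching[OF bp _ e _ ab(1)] ab(3) by metis
  qed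
  ultimately show ?thesis using four unfolding matching_covered_def by blast
qed

section \<open>Edge deletion, minimality and edge counts\<close>

lemma multigraph_delete_edge: "multigraph G \<Longrightarrow> multigraph (delete_edge G e)"
  by (simp add: multigraph_def delete_edge_def)

lemma bipartition_delete_edge: "bipartition G A B \<Longrightarrow> bipartition (delete_edge G e) A B"
  by (simp add: bipartition_def delete_edge_def)

lemma adj_delete_edge:
  assumes inj: "inj_on (ends G) (edges G)" and AB: "A \<inter> B = {}"
    and e: "e \<in> edges G" "ends G e = {a, b}" "a \<in> A" "b \<in> B"
  shows "adj (delete_edge G e) A B = adj G A B - {(a, b)}"
proof -
  have "e' \<noteq> e \<longleftrightarrow> (a', b') \<noteq> (a, b)"
    if "e' \<in> edges G" "ends G e' = {a', b'}" "a' \<in> A" "b' \<in> B" for e' a' b'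
  proof -
    have "{a', b'} = {a, b} \<longleftrightarrow> (a', b') = (a, b)"
      using that e AB by (auto simp: doubleton_eq_iff)
    then show ?thesis using inj that e unfolding inj_on_def by metis
  qed
  then show ?thesis unfolding adj_def delete_edge_def by fastforce
qed

text \<open>Deleting one of two parallel edges leaves \<open>adj\<close> unchanged, so minimality
  forbids them; without them, deleting an edge and deleting its pair agree.\<close>

lemma minimal_matching_covered_iff:
  assumes mg: "multigraph G" and bp: "bipartition G A B"
  shows "minimal_matching_covered G \<longleftrightarrow>
    inj_on (ends G) (edges G) \<and> 2 \<le> card A \<and> min_elementary A B (adj G A B)"
proof -
  have AB: "A \<inter> B = {}" and V: "verts G = A \<union> B"
    and E: "\<And>e. e \<in> edges G \<Longrightarrow> \<exists>a\<in>A. \<exists>b\<in>B. ends G e = {a, b}"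
    using bp unfolding bipartition_def by auto
  \<comment> \<open>Stated for any \<open>H\<close>, to serve for \<open>G\<close> and for each
    \<open>delete_edge G e\<close>.\<close>
  have mc: "matching_covered H \<longleftrightarrow> 2 \<le> card A \<and> elementary A B (adj H A B)"
    if H: "multigraph H" "bipartition H A B" for H :: "('a, 'b) mgraph"
  proof
    assume m: "matching_covered H"
    have el: "elementary A B (adj H A B)" using matching_covered_imp_elementary[OF H m] .
    have "4 \<le> card (A \<union> B)" using m H(2) unfolding matching_covered_def bipartition_def by metis
    then show "2 \<le> card A \<and> elementary A B (adj H A B)"
      using card_Un_disjoint[OF elementary_finite(1,2)[OF el] AB] elementary_finite(4)[OF el] el
      by simp
  qed (use elementary_imp_matching_covered[OF H] in blast)
  note del = mc[OF multigraph_delete_edge[OF mg] bipartition_delete_edge[OF bp]]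
  show ?thesis
  proof
    assume m: "minimal_matching_covered G"
    then have el: "2 \<le> card A" "elementary A B (adj G A B)"
      and min: "\<And>e. e \<in> edges G \<Longrightarrow> \<not> elementary A B (adj (delete_edge G e) A B)"
      using mc[OF mg bp] del unfolding minimal_matching_covered_def by auto
    have inj: "inj_on (ends G) (edges G)"
    proof (rule inj_onI, rule ccontr)
      fix e e' assume e: "e \<in> edges G" "e' \<in> edges G" "ends G e = ends G e'" "e \<noteq> e'"
      have "adj (delete_edge G e) A B = adj G A B"
        using e unfolding adj_def delete_edge_def by auto
      then show False using min[OF e(1)] el by simp
    qed
    have "\<not> elementary A B (adj G A B - {p})" if p: "p \<in> adj G A B" for p
    proof -
      obtain a b e where "p = (a, b)" "a \<in> A" "b \<in> B" "e \<in> edges G" "ends G e = {a, b}"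
        using p unfolding adj_def by blast
      then show ?thesis using min adj_delete_edge[OF inj AB] by metis
    qed
    then show "inj_on (ends G) (edges G) \<and> 2 \<le> card A \<and> min_elementary A B (adj G A B)"
      using inj el unfolding min_elementary_def by blast
  next
    assume r: "inj_on (ends G) (edges G) \<and> 2 \<le> card A \<and> min_elementary A B (adj G A B)"
    have "\<not> elementary A B (adj (delete_edge G e) A B)" if e: "e \<in> edges G" for e
    proof -
      obtain a b where ab: "a \<in> A" "b \<in> B" "ends G e = {a, b}" using E[OF e] by blast
      have "(a, b) \<in> adj G A B" using ab e unfolding adj_def by blast
      then show ?thesis
        using r adj_delete_edge[OF _ AB e ab(3,1,2)] unfolding min_elementary_def by metis
    qed
    then show "minimal_matching_covered G"
      using r mc[OF mg bp] del unfolding minimal_matching_covered_def min_elementary_def by blast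
  qed
qed

lemma card_edges_eq_card_adj:
  assumes bp: "bipartition G A B" and inj: "inj_on (ends G) (edges G)"
  shows "card (edges G) = card (adj G A B)"
proof -
  have AB: "A \<inter> B = {}" using bp unfolding bipartition_def by auto
  have "ends G ` edges G = (\<lambda>(a, b). {a, b}) ` adj G A B"
    using bp unfolding bipartition_def adj_def by (auto simp: image_iff) metis
  moreover have "inj_on (\<lambda>(a, b). {a, b}) (adj G A B)"
    unfolding inj_on_def adj_def using AB by (auto simp: doubleton_eq_iff)
  ultimately show ?thesis using inj by (metis card_image)
qed

text \<open>The edges at \<open>c\<close>, those at \<open>d\<close> and those given by
  \<open>\<phi>\<close> are three disjoint families of size \<open>card A - 1\<close>.\<close>

lemma card_star_rel:
  assumes st: "star_rel A B R c d \<phi>" and fin: "finite A"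
  shows "card R + 3 = 3 * card A"
proof -
  have c: "c \<in> A" "d \<in> B" and bij: "bij_betw \<phi> (A - {c}) (B - {d})"
    and R: "R = {(a, b). a = c \<and> b \<in> B - {d} \<or> a \<in> A - {c} \<and> (b = d \<or> b = \<phi> a)}"
    using st unfolding star_rel_def by auto
  have \<phi>: "\<phi> x \<noteq> d" if "x \<in> A - {c}" for x using bij that unfolding bij_betw_def by blast
  have fB: "finite (B - {d})" using bij fin by (metis bij_betw_finite finite_Diff)
  let ?R1 = "Pair c ` (B - {d})" and ?R2 = "(\<lambda>x. (x, d)) ` (A - {c})"
    and ?R3 = "(\<lambda>x. (x, \<phi> x)) ` (A - {c})"
  have "card ?R1 = card (B - {d})" "card ?R2 = card (A - {c})" "card ?R3 = card (A - {c})"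
    by (simp_all add: card_image inj_on_def)
  moreover have "card (?R1 \<union> ?R2 \<union> ?R3) = card ?R1 + card ?R2 + card ?R3"
    using fin fB \<phi> by (subst card_Un_disjoint; (subst card_Un_disjoint)?) auto
  moreover have "R = ?R1 \<union> ?R2 \<union> ?R3" unfolding R by auto
  moreover have "card (B - {d}) = card (A - {c})" using bij by (simp add: bij_betw_same_card)
  moreover have "card A = Suc (card (A - {c}))" using card_Suc_Diff1[OF fin c(1)] by simp
  ultimately show ?thesis by simp
qed

text \<open>Rules out extremal graphs on four vertices, where the required number of edges would be
  three.\<close>

lemma elementary_card_2:
  assumes el: "elementary A B R" and k: "card A = 2"
  shows "4 \<le> card R"
proof -
  obtain a a' where a: "A = {a, a'}" "a \<noteq> a'" using k by (auto simp: card_2_iff)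
  obtain b b' where b: "b \<noteq> b'" "(a, b) \<in> R" "(a, b') \<in> R"
    using elementary_degree_left[OF el, of a] k a by auto
  obtain d d' where d: "d \<noteq> d'" "(a', d) \<in> R" "(a', d') \<in> R"
    using elementary_degree_left[OF el, of a'] k a by auto
  have "card {(a, b), (a, b'), (a', d), (a', d')} = 4" using a b d by simp
  moreover have "{(a, b), (a, b'), (a', d), (a', d')} \<subseteq> R" using b d by simp
  ultimately show ?thesis using elementary_finite(3)[OF el] by (metis card_mono)
qed

theorem edge_extremal_iff_star_rel:
  assumes mg: "multigraph G"
  shows "edge_extremal G \<longleftrightarrow> (\<exists>A B c d \<phi>. bipartition G A B \<and> inj_on (ends G) (edges G) \<and>
    3 \<le> card A \<and> star_rel A B (adj G A B) c d \<phi>)"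
proof
  assume ext: "edge_extremal G"
  then obtain A B where bp: "bipartition G A B"
    unfolding edge_extremal_def bipartite_def bipartition_def by blast
  have inj: "inj_on (ends G) (edges G)" and k: "2 \<le> card A" and mn: "min_elementary A B (adj G A B)"
    using ext minimal_matching_covered_iff[OF mg bp] unfolding edge_extremal_def by auto
  have el: "elementary A B (adj G A B)" using mn unfolding min_elementary_def by blast
  have "card (verts G) = 2 * card A"
    using bp card_Un_disjoint[OF elementary_finite(1,2)[OF el]] elementary_finite(4)[OF el]
    unfolding bipartition_def by simp
  moreover have "real (card (edges G)) = (3 * real (card (verts G)) - 6) / 2"
    using ext unfolding edge_extremal_def by blast
  \<comment> \<open>\<open>n = 2 * card A\<close> turns \<open>(3n - 6) / 2\<close> into
    \<open>3 * card A - 3\<close>.\<close>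
  ultimately have card: "card (adj G A B) + 3 = 3 * card A"
    using card_edges_eq_card_adj[OF bp inj] by (simp add: field_simps)
  then have "3 \<le> card A" using elementary_card_2[OF el] k by (cases "card A = 2") auto
  then show "\<exists>A B c d \<phi>. bipartition G A B \<and> inj_on (ends G) (edges G) \<and>
    3 \<le> card A \<and> star_rel A B (adj G A B) c d \<phi>"
    using min_elementary_card[OF mn] card bp inj by blast
next
  assume "\<exists>A B c d \<phi>. bipartition G A B \<and> inj_on (ends G) (edges G) \<and>
    3 \<le> card A \<and> star_rel A B (adj G A B) c d \<phi>"
  then obtain A B c d \<phi> where bp: "bipartition G A B" and inj: "inj_on (ends G) (edges G)"
    and k: "3 \<le> card A" and st: "star_rel A B (adj G A B) c d \<phi>" by blast
  have fin: "finite A" using k by (metis card.infinite not_numeral_le_zero)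
  have mn: "min_elementary A B (adj G A B)" using star_rel_min_elementary[OF st fin k] .
  then have el: "elementary A B (adj G A B)" unfolding min_elementary_def by blast
  have "card (verts G) = 2 * card A"
    using bp card_Un_disjoint[OF elementary_finite(1,2)[OF el]] elementary_finite(4)[OF el]
    unfolding bipartition_def by simp
  moreover have "card (edges G) + 3 = 3 * card A"
    using card_star_rel[OF st fin] card_edges_eq_card_adj[OF bp inj] by simp
  ultimately have "real (card (edges G)) = (3 * real (card (verts G)) - 6) / 2"
    by (simp add: field_simps)
  moreover have "bipartite G" using bp unfolding bipartite_def bipartition_def by blast
  ultimately show "edge_extremal G"
    using minimal_matching_covered_iff[OF mg bp] inj k mn unfolding edge_extremal_def by simp
qed

section \<open>Isomorphic leaf matching of stars\<close>

definition is_star :: "('v, 'e) mgraph \<Rightarrow> 'v \<Rightarrow> 'v set \<Rightarrow> bool" where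
  "is_star T c L \<longleftrightarrow> multigraph T \<and> c \<notin> L \<and> 2 \<le> card L \<and> verts T = insert c L \<and>
     (\<forall>e\<in>edges T. \<exists>b\<in>L. ends T e = {c, b}) \<and>
     (\<forall>b\<in>L. \<exists>!e. e \<in> edges T \<and> ends T e = {c, b})"

section \<open>Centre, leaves and acyclicity of a star\<close>

lemma star_iff: "star T \<longleftrightarrow> (\<exists>c L. is_star T c L)"
proof
  assume "star T"
  then obtain p A B where p: "2 \<le> p" "multigraph T" "A \<inter> B = {}" "verts T = A \<union> B" "card A = 1"
    "card B = p" "\<forall>e\<in>edges T. \<exists>a\<in>A. \<exists>b\<in>B. ends T e = {a, b}"
    "\<forall>a\<in>A. \<forall>b\<in>B. \<exists>!e. e \<in> edges T \<and> ends T e = {a, b}"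
    unfolding star_def complete_bipartite_def by blast
  obtain c where "A = {c}" using p(5) card_1_singletonE by blast
  then have "is_star T c B" unfolding is_star_def using p by simp
  then show "\<exists>c L. is_star T c L" by blast
next
  assume "\<exists>c L. is_star T c L"
  then obtain c L where s: "is_star T c L" by blast
  have "complete_bipartite T 1 (card L)"
    unfolding complete_bipartite_def
    by (intro conjI exI[of _ "{c}"] exI[of _ L]) (use s in \<open>auto simp: is_star_def\<close>)
  then show "star T" using s unfolding star_def is_star_def by blast
qed

lemma is_star_edge_inj:
  assumes "is_star T c L" "e \<in> edges T" "e' \<in> edges T" "ends T e = ends T e'"
  shows "e = e'"
proof -
  obtain b where "b \<in> L" "ends T e = {c, b}" using assms unfolding is_star_def by blast
  then show ?thesis using assms unfolding is_star_def by metis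
qed

text \<open>A single edge at \<open>c\<close> would contain \<open>c\<close> and every leaf, more
  than its two ends. With only one leaf, the centre would itself be a leaf and be matched to its
  copy.\<close>

lemma is_star_leaves:
  assumes s: "is_star T c L"
  shows "leaves T = L"
proof -
  have cL: "c \<notin> L" and k: "2 \<le> card L" and V: "verts T = insert c L"
    and E: "\<And>e. e \<in> edges T \<Longrightarrow> \<exists>b\<in>L. ends T e = {c, b}"
    and ex: "\<And>b. b \<in> L \<Longrightarrow> \<exists>!e. e \<in> edges T \<and> ends T e = {c, b}"
    and fin: "finite (edges T)"
    using s unfolding is_star_def multigraph_def by auto
  have "degree T b = 1" if b: "b \<in> L" for b
  proof -
    obtain e where e: "e \<in> edges T" "ends T e = {c, b}" using ex[OF b] by blast
    have "{e \<in> edges T. b \<in> ends T e} = {e}"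
    proof (intro equalityI subsetI)
      fix e' assume e': "e' \<in> {e \<in> edges T. b \<in> ends T e}"
      then obtain b' where "ends T e' = {c, b'}" using E by blast
      then have "ends T e' = ends T e" using e' b cL e(2) by auto
      then show "e' \<in> {e}" using is_star_edge_inj[OF s _ e(1)] e' by blast
    qed (use e in auto)
    then show ?thesis unfolding degree_def by simp
  qed
  moreover have "degree T c \<noteq> 1"
  proof
    assume "degree T c = 1"
    then obtain e where e: "{e \<in> edges T. c \<in> ends T e} = {e}"
      unfolding degree_def by (meson card_1_singletonE)
    have "L \<subseteq> ends T e"
    proof
      fix b assume "b \<in> L"
      then obtain e' where "e' \<in> edges T" "ends T e' = {c, b}" using ex by blast
      then show "b \<in> ends T e" using e by auto
    qed
    then have "insert c L \<subseteq> ends T e" using e by blast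
    moreover have "e \<in> edges T" using e by blast
    then have two: "card (ends T e) = 2" using s unfolding is_star_def multigraph_def by blast
    then have "finite (ends T e)" by (metis card.infinite zero_neq_numeral)
    ultimately have "card (insert c L) \<le> 2" using two by (metis card_mono)
    moreover have "finite L" using k by (metis card.infinite not_numeral_le_zero)
    ultimately show False using k cL by simp
  qed
  ultimately show ?thesis unfolding leaves_def V by auto
qed

text \<open>Every edge contains the centre, so a cycle of length at least three would pass through
  it twice; lengths one and two would need a loop or parallel edges.\<close>

lemma is_star_tree:
  assumes s: "is_star T c L"
  shows "tree T"
proof -
  have mg: "multigraph T" and cL: "c \<notin> L" and V: "verts T = insert c L"
    and E: "\<And>e. e \<in> edges T \<Longrightarrow> \<exists>b\<in>L. ends T e = {c, b}"
    and ex: "\<And>b. b \<in> L \<Longrightarrow> \<exists>!e. e \<in> edges T \<and> ends T e = {c, b}"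
    using s unfolding is_star_def by auto
  have "connected_graph T"
  proof (rule connected_graphI_closed)
    show "verts T \<noteq> {}" using V by simp
    show "ends T e \<subseteq> verts T \<and> card (ends T e) = 2" if "e \<in> edges T" for e
      using mg that unfolding multigraph_def by blast
    fix S assume S: "S \<subseteq> verts T" "S \<noteq> {}"
      and cl: "\<And>e. e \<in> edges T \<Longrightarrow> ends T e \<inter> S \<noteq> {} \<Longrightarrow> ends T e \<subseteq> S"
    have "c \<in> S \<longleftrightarrow> b \<in> S" if b: "b \<in> L" for b
    proof -
      obtain e where "e \<in> edges T" "ends T e = {c, b}" using ex[OF b] by blast
      then show ?thesis using cl[of e] by auto
    qed
    moreover obtain x where "x \<in> S" "x = c \<or> x \<in> L" using S V by blast
    ultimately have "c \<in> S" "L \<subseteq> S" by blast+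
    then show "S = verts T" using S(1) V by auto
  qed
  moreover have False if cyc: "is_cycle T vs es" for vs es
  proof -
    have w: "length vs = Suc (length es)" "set es \<subseteq> edges T"
      "\<And>i. i < length es \<Longrightarrow> ends T (es ! i) = {vs ! i, vs ! Suc i}"
      and ne: "es \<noteq> []" and cl: "hd vs = last vs" and d: "distinct (tl vs)" "distinct es"
      using cyc unfolding is_cycle_def is_walk_def by auto
    have vs: "vs \<noteq> []" using w(1) by auto
    have c_in: "c = vs ! i \<or> c = vs ! Suc i" if i: "i < length es" for i
    proof -
      have "es ! i \<in> edges T" using w(2) i nth_mem by blast
      then show ?thesis using E w(3)[OF i] by (metis insertI1 insertE singletonD)
    qed
    have dist: "vs ! Suc i \<noteq> vs ! Suc j" if "i < length es" "j < length es" "i \<noteq> j" for i j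
      using d(1) that w(1) by (simp add: nth_tl[symmetric] nth_eq_iff_index_eq)
    have closed: "vs ! 0 = vs ! length es"
      using cl vs w(1) by (simp add: hd_conv_nth last_conv_nth)
    have len: "0 < length es" using ne by simp
    consider "length es = 1" | "length es = 2" | "3 \<le> length es" using len by linarith
    then show False
    proof cases
      case 1
      have "es ! 0 \<in> edges T" using w(2) len nth_mem by blast
      then have "card (ends T (es ! 0)) = 2" using mg unfolding multigraph_def by blast
      moreover have "ends T (es ! 0) = {vs ! 0}" using w(3)[OF len] closed 1 by simp
      ultimately show False by simp
    next
      case 2
      have "ends T (es ! 0) = ends T (es ! 1)"
        using w(3)[of 0] w(3)[of 1] 2 closed by (auto simp: numeral_2_eq_2)
      moreover have "es ! 0 \<in> edges T" "es ! 1 \<in> edges T" using w(2) 2 nth_mem by auto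
      ultimately have "es ! 0 = es ! 1" using is_star_edge_inj[OF s] by blast
      then show False using d(2) 2 by (simp add: nth_eq_iff_index_eq)
    next
      case 3
      then have l: "0 < length es" "1 < length es" "2 < length es" by linarith+
      have d': "vs ! 1 \<noteq> vs ! 2" "vs ! 1 \<noteq> vs ! 3"
        using dist[OF l(1,2)] dist[OF l(1,3)] by (simp_all add: eval_nat_numeral)
      have c': "c = vs ! 0 \<or> c = vs ! 1" "c = vs ! 1 \<or> c = vs ! 2" "c = vs ! 2 \<or> c = vs ! 3"
        using c_in[OF l(1)] c_in[OF l(2)] c_in[OF l(3)] by (simp_all add: eval_nat_numeral)
      \<comment> \<open>With \<open>c\<close> at position 1, the third edge would put it at position
        2 or 3 as well. So it is at 2 and 0, and, the walk being closed, also at the last position: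
        twice in \<open>tl vs\<close>.\<close>
      then have "c = vs ! 2" "c = vs ! 0" using d' by metis+
      then have "vs ! Suc (length es - 1) = vs ! Suc 1"
        using closed len by (simp add: numeral_2_eq_2)
      moreover have "length es - 1 < length es" "length es - 1 \<noteq> 1" using 3 by linarith+
      ultimately show False using dist[OF _ l(2)] by blast
    qed
  qed
  ultimately show ?thesis using mg unfolding tree_def by blast
qed

text \<open>The colour classes cross the two copies: each consists of the centre of one copy and the
  leaves of the other. Accordingly \<open>\<phi>\<close> is the inverse of \<open>f\<close> on the
  leaves.\<close>

lemma star_leaf_matching_imp_star_rel:
  assumes star: "is_star T c L" and ilm: "isomorphic_leaf_matching T G"
  shows "\<exists>A B c d \<phi>. bipartition G A B \<and> inj_on (ends G) (edges G) \<and> 3 \<le> card A \<and>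
    star_rel A B (adj G A B) c d \<phi>"
proof -
  have cL: "c \<notin> L" and k: "2 \<le> card L" and V: "verts T = insert c L"
    and E: "\<And>e. e \<in> edges T \<Longrightarrow> \<exists>b\<in>L. ends T e = {c, b}"
    and ex: "\<And>b. b \<in> L \<Longrightarrow> \<exists>e. e \<in> edges T \<and> ends T e = {c, b}"
    using star unfolding is_star_def by blast+
  have finL: "finite L" using k by (metis card.infinite not_numeral_le_zero)
  note lv = is_star_leaves[OF star]
  obtain T' f g m where iso: "graph_iso f g T T'" and VV: "verts T \<inter> verts T' = {}"
    and m: "inj_on m L" and VG: "verts G = verts T \<union> verts T'"
    and EG: "edges G = edges T \<union> edges T' \<union> m ` L"
    and G1: "\<And>e. e \<in> edges T \<Longrightarrow> ends G e = ends T e"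
    and G2: "\<And>e. e \<in> edges T' \<Longrightarrow> ends G e = ends T' e"
    and G3: "\<And>v. v \<in> L \<Longrightarrow> ends G (m v) = {v, f v}"
    using ilm unfolding isomorphic_leaf_matching_def lv by metis
  have f: "inj_on f (insert c L)" "f ` insert c L = verts T'" and g: "inj_on g (edges T)"
    and gE: "edges T' = g ` edges T" and gends: "\<And>e. e \<in> edges T \<Longrightarrow> ends T' (g e) = f ` ends T e"
    using iso V unfolding graph_iso_def bij_betw_def by auto
  have disj: "x \<noteq> f y" if "x \<in> insert c L" "y \<in> insert c L" for x y
    using VV f(2) V that by blast
  have finj: "f x = f y \<longleftrightarrow> x = y" if "x \<in> insert c L" "y \<in> insert c L" for x y
    using f(1) that unfolding inj_on_def by blast
  define A where "A = insert c (f ` L)"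
  define B where "B = insert (f c) L"
  have E1: "\<exists>b\<in>L. ends G e = {c, b}" if "e \<in> edges T" for e
    using E G1 that by metis
  have E2: "\<exists>b\<in>L. ends G e = {f c, f b}" if e: "e \<in> edges T'" for e
  proof -
    obtain e' where e': "e' \<in> edges T" "e = g e'" using gE e by blast
    obtain b where b: "b \<in> L" "ends T e' = {c, b}" using E[OF e'(1)] by blast
    have "ends G e = {f c, f b}" using G2[OF e] gends[OF e'(1)] e'(2) b(2) by simp
    then show ?thesis using b by blast
  qed
  have edge_cases: "(\<exists>b\<in>L. e \<in> edges T \<and> ends G e = {c, b}) \<or>
      (\<exists>b\<in>L. e \<in> edges T' \<and> ends G e = {f c, f b}) \<or> (\<exists>b\<in>L. e = m b \<and> ends G e = {b, f b})"
    if eG: "e \<in> edges G" for e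
  proof -
    consider "e \<in> edges T" | "e \<in> edges T'" | b where "b \<in> L" "e = m b"
      using eG unfolding EG by blast
    then show ?thesis
    proof cases
      case 1
      then show ?thesis using E1[OF 1] by blast
    next
      case 2
      then show ?thesis using E2[OF 2] by blast
    next
      case 3
      then show ?thesis using G3[OF 3(1)] by blast
    qed
  qed
  have bp: "bipartition G A B"
    unfolding bipartition_def
  proof (intro conjI ballI)
    show "A \<inter> B = {}" unfolding A_def B_def using disj cL finj by auto
    show "verts G = A \<union> B" unfolding A_def B_def VG V f(2)[symmetric] by auto
    fix e assume "e \<in> edges G"
    from edge_cases[OF this] show "\<exists>a\<in>A. \<exists>b\<in>B. ends G e = {a, b}"
    proof (elim disjE bexE conjE)
      fix b assume "b \<in> L" "ends G e = {c, b}"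
      then show ?thesis unfolding A_def B_def by blast
    next
      fix b assume "b \<in> L" "ends G e = {f c, f b}"
      then have "f b \<in> A" "f c \<in> B" "ends G e = {f b, f c}" unfolding A_def B_def by auto
      then show ?thesis by blast
    next
      fix b assume "b \<in> L" "ends G e = {b, f b}"
      then have "f b \<in> A" "b \<in> B" "ends G e = {f b, b}" unfolding A_def B_def by auto
      then show ?thesis by blast
    qed
  qed
  have inj: "inj_on (ends G) (edges G)"
  proof (rule inj_onI)
    fix e e' assume e: "e \<in> edges G" "e' \<in> edges G" and eq: "ends G e = ends G e'"
    \<comment> \<open>The centre contained in an edge reveals its family, so edges with equal ends
      belong to the same one.\<close>
    have "e \<in> edges T \<and> c \<in> ends G e \<or> e \<in> edges T' \<and> f c \<in> ends G e \<or>
        (\<exists>b\<in>L. e = m b) \<and> c \<notin> ends G e \<and> f c \<notin> ends G e" if "e \<in> edges G" for e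
      using edge_cases[OF that]
    proof (elim disjE bexE conjE)
      fix b assume b: "b \<in> L" "e = m b" "ends G e = {b, f b}"
      have "c \<noteq> b" "f c \<noteq> f b" using b(1) cL finj[of c b] by auto
      then have "c \<notin> ends G e" "f c \<notin> ends G e" using b disj[of c b] disj[of b c] by auto
      then show ?thesis using b by blast
    qed simp_all
    note cls = this
    have no: "c \<notin> ends G e" if "e \<in> edges T'" for e
    proof -
      obtain b where "b \<in> L" "ends G e = {f c, f b}" using E2[OF \<open>e \<in> edges T'\<close>] by blast
      then show ?thesis using disj[of c c] disj[of c b] by auto
    qed
    consider "e \<in> edges T" "e' \<in> edges T" | "e \<in> edges T'" "e' \<in> edges T'"
      | b b' where "b \<in> L" "b' \<in> L" "e = m b" "e' = m b'"
      using cls[OF e(1)] cls[OF e(2)] no eq by metis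
    then show "e = e'"
    proof cases
      case 1
      then show ?thesis using is_star_edge_inj[OF star 1] eq G1 by simp
    next
      case 2
      obtain e1 e2 where g12: "e1 \<in> edges T" "e = g e1" "e2 \<in> edges T" "e' = g e2"
        using gE 2 by blast
      have im: "f ` ends T e1 = f ` ends T e2"
        using eq G2[OF 2(1)] G2[OF 2(2)] gends[OF g12(1)] gends[OF g12(3)] g12(2,4) by simp
      have "ends T e1 \<subseteq> insert c L" "ends T e2 \<subseteq> insert c L"
        using E[OF g12(1)] E[OF g12(3)] by auto
      then have "ends T e1 = ends T e2" using im f(1) by (metis inj_on_image_eq_iff)
      then show ?thesis using is_star_edge_inj[OF star g12(1,3)] g12 by simp
    next
      case 3
      have "{b, f b} = {b', f b'}" using eq G3 3 by simp
      then have "b = b'" using disj[of b b'] 3 by (metis doubleton_eq_iff insertCI)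
      then show ?thesis using 3 by simp
    qed
  qed
  define \<phi> where "\<phi> = inv_into L f"
  have injL: "inj_on f L" using f(1) by (rule inj_on_subset) blast
  have \<phi>f: "\<phi> (f b) = b" if "b \<in> L" for b unfolding \<phi>_def using injL that by (rule inv_into_f_f)
  have A': "A - {c} = f ` L" and B': "B - {f c} = L"
    unfolding A_def B_def using disj[of c] disj[of _ c] by auto
  have "bij_betw \<phi> (A - {c}) (B - {f c})"
    unfolding A' B' \<phi>_def using injL by (intro bij_betw_inv_into) (simp add: bij_betw_def)
  moreover have "adj G A B = {(a, b). a = c \<and> b \<in> B - {f c} \<or>
      a \<in> A - {c} \<and> (b = f c \<or> b = \<phi> a)}" (is "_ = ?R")
  proof (intro equalityI subrelI)
    fix a b assume "(a, b) \<in> adj G A B"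
    then obtain e where e: "a \<in> A" "b \<in> B" "e \<in> edges G" "ends G e = {a, b}"
      unfolding adj_def by blast
    have AB: "A \<inter> B = {}" using bp unfolding bipartition_def by blast
    from edge_cases[OF e(3)] show "(a, b) \<in> ?R"
    proof (elim disjE bexE conjE)
      fix x assume "x \<in> L" "ends G e = {c, x}"
      then have "a = c" "b = x" using e AB unfolding A_def B_def by (auto simp: doubleton_eq_iff)
      then show ?thesis using \<open>x \<in> L\<close> B' by auto
    next
      fix x assume "x \<in> L" "ends G e = {f c, f x}"
      then have "a = f x" "b = f c" using e AB unfolding A_def B_def by (auto simp: doubleton_eq_iff)
      then show ?thesis using \<open>x \<in> L\<close> A' by auto
    next
      fix x assume "x \<in> L" "ends G e = {x, f x}"
      then have "a = f x" "b = x" using e AB unfolding A_def B_def by (auto simp: doubleton_eq_iff)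
      then show ?thesis using \<open>x \<in> L\<close> A' \<phi>f by auto
    qed
  next
    fix a b assume "(a, b) \<in> ?R"
    then consider "a = c" "b \<in> L" | x where "x \<in> L" "a = f x" "b = f c" | x where "x \<in> L" "a = f x" "b = x"
      using A' B' \<phi>f by auto
    then show "(a, b) \<in> adj G A B"
    proof cases
      case 1
      obtain e where "e \<in> edges T" "ends T e = {c, b}" using ex[OF 1(2)] by blast
      then have "e \<in> edges G" "ends G e = {a, b}" using EG G1 1 by auto
      then show ?thesis using 1 unfolding adj_def A_def B_def by blast
    next
      case 2
      obtain e where e: "e \<in> edges T" "ends T e = {c, x}" using ex[OF 2(1)] by blast
      then have "g e \<in> edges T'" using gE by blast
      then have "g e \<in> edges G" "ends G (g e) = {a, b}" using EG G2 gends[OF e(1)] e(2) 2 by auto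
      then show ?thesis using 2 unfolding adj_def A_def B_def by blast
    next
      case 3
      then have "m x \<in> edges G" "ends G (m x) = {a, b}" using EG G3 by auto
      then show ?thesis using 3 unfolding adj_def A_def B_def by blast
    qed
  qed
  ultimately have "star_rel A B (adj G A B) c (f c) \<phi>"
    unfolding star_rel_def A_def B_def by blast
  moreover have "3 \<le> card A"
  proof -
    have "c \<notin> f ` L" using disj[of c] by blast
    then show ?thesis unfolding A_def using k finL injL by (simp add: card_image)
  qed
  ultimately show ?thesis using bp inj by blast
qed

text \<open>\<open>T\<close> has centre \<open>c\<close> and leaves in \<open>B\<close>, its copy
  has centre \<open>d\<close> and leaves in \<open>A\<close>. As \<open>\<phi>\<close> leads from
  the copy to \<open>T\<close>, its inverse \<open>\<psi>\<close> supplies the isomorphism.\<close>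

lemma star_rel_imp_star_leaf_matching:
  fixes G :: "('v, 'e) mgraph"
  assumes mg: "multigraph G" and bp: "bipartition G A B" and inj: "inj_on (ends G) (edges G)"
    and k: "3 \<le> card A" and st: "star_rel A B (adj G A B) c d \<phi>"
  shows "\<exists>T :: ('v, 'e) mgraph. star T \<and> isomorphic_leaf_matching T G"
proof -
  have AB: "A \<inter> B = {}" and V: "verts G = A \<union> B"
    and E: "\<And>e. e \<in> edges G \<Longrightarrow> \<exists>a\<in>A. \<exists>b\<in>B. ends G e = {a, b}"
    using bp unfolding bipartition_def by auto
  have c: "c \<in> A" "d \<in> B" and bij: "bij_betw \<phi> (A - {c}) (B - {d})"
    and R: "adj G A B = {(a, b). a = c \<and> b \<in> B - {d} \<or> a \<in> A - {c} \<and> (b = d \<or> b = \<phi> a)}"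
    using st unfolding star_rel_def by auto
  have fin: "finite A" "finite B" using mg V unfolding multigraph_def by auto
  define L where "L = B - {d}"
  define K where "K = A - {c}"
  define \<psi> where "\<psi> = inv_into K \<phi>"
  have \<psi>: "bij_betw \<psi> L K" unfolding \<psi>_def L_def K_def using bij by (rule bij_betw_inv_into)
  have \<phi>\<psi>: "\<phi> (\<psi> b) = b" if "b \<in> L" for b
    unfolding \<psi>_def using bij that bij_betw_inv_into_right unfolding L_def K_def by metis
  have \<psi>K: "\<psi> b \<in> K" if "b \<in> L" for b using \<psi> that unfolding bij_betw_def by blast
  have \<psi>inj: "\<psi> b = \<psi> b' \<longleftrightarrow> b = b'" if "b \<in> L" "b' \<in> L" for b b'
    using \<psi> that unfolding bij_betw_def inj_on_def by blast
  have LK: "L \<subseteq> B" "K \<subseteq> A" "c \<notin> L" "c \<notin> K" "d \<notin> L" "d \<notin> K" "c \<noteq> d" "L \<inter> K = {}"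
    unfolding L_def K_def using c AB by auto
  have "card K = card A - 1" unfolding K_def using c fin by simp
  then have cK: "2 \<le> card K" and cL: "2 \<le> card L" using k bij_betw_same_card[OF \<psi>] by simp_all
  \<comment> \<open>The edge object with given ends, unique because \<open>ends\<close> is injective
    on the edges.\<close>
  define \<epsilon> where "\<epsilon> a b = inv_into (edges G) (ends G) {a, b}" for a b
  have \<epsilon>: "\<epsilon> a b \<in> edges G" "ends G (\<epsilon> a b) = {a, b}" if "(a, b) \<in> adj G A B" for a b
  proof -
    have "{a, b} \<in> ends G ` edges G" using that unfolding adj_def by auto
    then show "\<epsilon> a b \<in> edges G" "ends G (\<epsilon> a b) = {a, b}"
      unfolding \<epsilon>_def by (simp_all add: inv_into_into f_inv_into_f)
  qed
  have \<epsilon>eq: "\<epsilon> a b = e" if "e \<in> edges G" "ends G e = {a, b}" for a b e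
    unfolding \<epsilon>_def using inv_into_f_f[OF inj that(1)] that(2) by simp
  have adj1: "(c, b) \<in> adj G A B" and adj2: "(\<psi> b, d) \<in> adj G A B"
    and adj3: "(\<psi> b, b) \<in> adj G A B" if "b \<in> L" for b
    using that \<psi>K[OF that] \<phi>\<psi>[OF that] unfolding R L_def K_def by auto
  \<comment> \<open>Both stars reuse the edge objects and \<open>ends\<close> of \<open>G\<close>,
    since they have to be literal subgraphs of \<open>G\<close>.\<close>
  define T where "T = \<lparr>verts = insert c L, edges = \<epsilon> c ` L, ends = ends G\<rparr>"
  define T' where "T' = \<lparr>verts = insert d K, edges = (\<lambda>b. \<epsilon> (\<psi> b) d) ` L, ends = ends G\<rparr>"
  define f where "f v = (if v = c then d else \<psi> v)" for v
  \<comment> \<open>\<open>\<beta>\<close> recovers the leaf from an edge at \<open>c\<close>, so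
    that \<open>g\<close> can follow \<open>f\<close>: the edge from \<open>c\<close> to
    \<open>b\<close> goes to the edge from \<open>\<psi> b\<close> to \<open>d\<close>.\<close>
  define \<beta> where "\<beta> = inv_into L (\<epsilon> c)"
  define g where "g e = \<epsilon> (\<psi> (\<beta> e)) d" for e
  define m where "m b = \<epsilon> (\<psi> b) b" for b
  have inj1: "inj_on (\<epsilon> c) L"
  proof (rule inj_onI)
    fix x y assume "x \<in> L" "y \<in> L" "\<epsilon> c x = \<epsilon> c y"
    then have "{c, x} = {c, y}" using \<epsilon>(2)[OF adj1] by metis
    then show "x = y" by (metis doubleton_eq_iff)
  qed
  have inj2: "inj_on (\<lambda>b. \<epsilon> (\<psi> b) d) L"
  proof (rule inj_onI)
    fix x y assume xy: "x \<in> L" "y \<in> L" "\<epsilon> (\<psi> x) d = \<epsilon> (\<psi> y) d"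
    then have "{\<psi> x, d} = {\<psi> y, d}" using \<epsilon>(2)[OF adj2] by metis
    then have "\<psi> x = \<psi> y" by (metis doubleton_eq_iff)
    then show "x = y" using \<psi>inj xy by blast
  qed
  have inj3: "inj_on m L"
  proof (rule inj_onI)
    fix x y assume xy: "x \<in> L" "y \<in> L" "m x = m y"
    then have "{\<psi> x, x} = {\<psi> y, y}" unfolding m_def using \<epsilon>(2)[OF adj3] by metis
    then show "x = y" using xy \<psi>K LK(8) by (metis disjoint_iff doubleton_eq_iff)
  qed
  have \<beta>: "\<beta> (\<epsilon> c b) = b" if "b \<in> L" for b unfolding \<beta>_def using inj1 that by (rule inv_into_f_f)
  have star: "is_star T c L"
    unfolding is_star_def
  proof (intro conjI ballI)
    show "multigraph T"
      unfolding multigraph_def T_def using fin LK(3) \<epsilon>(2)[OF adj1]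
      by (auto simp: L_def card_insert_if)
    show "c \<notin> L" "2 \<le> card L" "verts T = insert c L" using LK cL by (simp_all add: T_def)
    show "\<exists>b\<in>L. ends T e = {c, b}" if "e \<in> edges T" for e
      using that \<epsilon>(2)[OF adj1] unfolding T_def by auto
    show "\<exists>!e. e \<in> edges T \<and> ends T e = {c, b}" if b: "b \<in> L" for b
    proof (rule ex1I[of _ "\<epsilon> c b"])
      show "\<epsilon> c b \<in> edges T \<and> ends T (\<epsilon> c b) = {c, b}" using b \<epsilon>(2)[OF adj1] unfolding T_def by auto
      fix e assume "e \<in> edges T \<and> ends T e = {c, b}"
      then have "e \<in> edges G" "ends G e = {c, b}" using \<epsilon>(1)[OF adj1] unfolding T_def by auto
      then show "e = \<epsilon> c b" using \<epsilon>eq by simp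
    qed
  qed
  have lv: "leaves T = L" using is_star_leaves[OF star] .
  have iso: "graph_iso f g T T'"
    unfolding graph_iso_def
  proof (intro conjI ballI)
    have "inj_on f (insert c L)"
      unfolding f_def inj_on_def using \<psi>inj \<psi>K LK by auto
    moreover have "f ` insert c L = insert d K"
    proof -
      have "f ` L = \<psi> ` L" unfolding f_def using LK(3) by auto
      also have "\<dots> = K" using \<psi> unfolding bij_betw_def by blast
      finally have "f ` L = K" .
      moreover have "f c = d" by (simp add: f_def)
      ultimately show ?thesis by simp
    qed
    ultimately show "bij_betw f (verts T) (verts T')" unfolding bij_betw_def T_def T'_def by simp
    have gb: "g (\<epsilon> c b) = \<epsilon> (\<psi> b) d" if "b \<in> L" for b unfolding g_def using \<beta>[OF that] by simp
    have "inj_on g (\<epsilon> c ` L)"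
    proof (rule inj_onI)
      fix x y assume "x \<in> \<epsilon> c ` L" "y \<in> \<epsilon> c ` L" "g x = g y"
      then obtain b b' where b: "b \<in> L" "x = \<epsilon> c b" "b' \<in> L" "y = \<epsilon> c b'" "\<epsilon> (\<psi> b) d = \<epsilon> (\<psi> b') d"
        using gb by auto
      then have "b = b'" using inj2 unfolding inj_on_def by blast
      then show "x = y" using b by simp
    qed
    moreover have "g ` \<epsilon> c ` L = (\<lambda>b. \<epsilon> (\<psi> b) d) ` L" unfolding image_image using gb by (rule image_cong[OF refl])
    ultimately show "bij_betw g (edges T) (edges T')" unfolding bij_betw_def T_def T'_def by simp
    fix e assume "e \<in> edges T"
    then obtain b where b: "b \<in> L" "e = \<epsilon> c b" unfolding T_def by auto
    have "b \<noteq> c" using b LK by blast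
    then have "f ` {c, b} = {\<psi> b, d}" by (auto simp: f_def)
    then show "ends T' (g e) = f ` ends T e"
      using b(2) gb[OF b(1)] \<epsilon>(2)[OF adj1[OF b(1)]] \<epsilon>(2)[OF adj2[OF b(1)]]
      by (simp add: T_def T'_def)
  qed
  have EG: "edges G = edges T \<union> edges T' \<union> m ` L"
  proof (intro equalityI subsetI)
    fix e assume e: "e \<in> edges G"
    obtain a b where ab: "a \<in> A" "b \<in> B" "ends G e = {a, b}" using E[OF e] by blast
    have eeq: "e = \<epsilon> a b" using \<epsilon>eq[OF e ab(3)] by simp
    have "(a, b) \<in> adj G A B" using ab e unfolding adj_def by blast
    then consider "a = c" "b \<in> L" | "a \<in> K" "b = d" | "a \<in> K" "b = \<phi> a"
      unfolding R L_def K_def by auto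
    then show "e \<in> edges T \<union> edges T' \<union> m ` L"
    proof cases
      case 1
      then show ?thesis unfolding eeq T_def by simp
    next
      case 2
      then obtain x where x: "x \<in> L" "a = \<psi> x" using \<psi> unfolding bij_betw_def by blast
      have "e = \<epsilon> (\<psi> x) d" using eeq x 2 by simp
      then have "e \<in> edges T'" unfolding T'_def using x(1) by simp
      then show ?thesis by blast
    next
      case 3
      then obtain x where x: "x \<in> L" "a = \<psi> x" using \<psi> unfolding bij_betw_def by blast
      have "e = m x" using eeq x 3 \<phi>\<psi>[OF x(1)] by (simp add: m_def)
      then show ?thesis using x(1) by blast
    qed
  next
    fix e assume "e \<in> edges T \<union> edges T' \<union> m ` L"
    then show "e \<in> edges G"
      unfolding T_def T'_def m_def using \<epsilon>(1)[OF adj1] \<epsilon>(1)[OF adj2] \<epsilon>(1)[OF adj3] by auto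
  qed
  have endsT: "\<exists>b\<in>L. ends G e = {c, b}" if "e \<in> edges T" for e
    using that \<epsilon>(2)[OF adj1] unfolding T_def by auto
  have endsT': "\<exists>b\<in>L. ends G e = {\<psi> b, d}" if "e \<in> edges T'" for e
    using that \<epsilon>(2)[OF adj2] unfolding T'_def by auto
  have endsm: "ends G (m b) = {\<psi> b, b}" if "b \<in> L" for b
    using \<epsilon>(2)[OF adj3[OF that]] unfolding m_def .
  have notd: "d \<notin> ends G e" if "e \<in> edges T" for e using endsT[OF that] LK by auto
  have notcd: "c \<notin> ends G (m b) \<and> d \<notin> ends G (m b)" if "b \<in> L" for b
    using endsm[OF that] \<psi>K[OF that] that LK by auto
  have "edges T \<inter> edges T' = {}" using notd endsT' by blast
  moreover have "m ` L \<inter> (edges T \<union> edges T') = {}" using notcd endsT endsT' by blast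
  moreover have "verts T \<inter> verts T' = {}" using LK by (auto simp: T_def T'_def)
  moreover have "verts G = verts T \<union> verts T'" unfolding V T_def T'_def L_def K_def using c by auto
  moreover have "\<forall>v\<in>L. ends G (m v) = {v, f v}" using endsm LK(3) by (auto simp: f_def)
  moreover have "2 \<le> card (verts T)"
    using cL LK(3) fin by (simp add: T_def L_def)
  ultimately have "isomorphic_leaf_matching T G"
    unfolding isomorphic_leaf_matching_def lv
    using is_star_tree[OF star] iso inj3 EG
    by (intro conjI exI[of _ T'] exI[of _ f] exI[of _ g] exI[of _ m]) (auto simp: T_def T'_def)
  moreover have "star T" using star star_iff by blast
  ultimately show ?thesis by blast
qed

theorem theorem1p5:
  fixes G :: "('v, 'e) mgraph"
  assumes "multigraph G"
  shows "edge_extremal G \<longleftrightarrow>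
    (\<exists>T :: ('v, 'e) mgraph. star T \<and> isomorphic_leaf_matching T G)"
  using edge_extremal_iff_star_rel[OF assms] star_rel_imp_star_leaf_matching[OF assms]
    star_leaf_matching_imp_star_rel star_iff by metis

end
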